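(* Let $H$ be a Hilbert space and let $T_1,T_2,S_1,S_2\in B(H)$ be rank one operators satisfying $T_1\otimes T_2\perp_{BJ}S_1\otimes S_2$ in $B(H)\otimes^{\min}B(H)$. Then either $T_1\perp_{BJ}S_1$ or $T_2\perp_{BJ}S_2$.
   Context: Hilbert spaces are complex; $B(H)$ is the $C^*$-algebra of bounded linear operators on $H$ with the operator norm. For a complex normed space $Z$ and $u,v\in Z$, $u$ is Birkhoff-James orthogonal to $v$, written $u\perp_{BJ}v$, if $\|u+\alpha v\|\ge\|u\|$ for all $\alpha\in\mathbb{C}$. For $C^*$-algebras $A$ and $B$, $A\otimes^{\min}B$ is the minimal $C^*$-tensor product, i.e. the completion of the algebraic tensor product $A\otimes B$ in the norm $\|u\|_{\min}=\sup\{\|(\pi_1\otimes\pi_2)(u)\|\}$, the supremum being over representations $\pi_1$ of $A$ and $\pi_2$ of $B$; $B(H)\otimes^{\min}B(H)$ embeds isometrically in $B(H\bar\otimes H)$, where $H\bar\otimes H$ is the Hilbert space tensor product. "Either ... or" is inclusive. *)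

theory Defs
  imports "HOL-Analysis.Analysis" "HOL-Library.Poly_Mapping"
begin

section \<open>Complex normed spaces and Hilbert spaces\<close>

class scaleC =
  fixes scaleC :: "complex \<Rightarrow> 'a \<Rightarrow> 'a"  (infixr \<open>*\<^sub>C\<close> 75)

class complex_vector = scaleC + ab_group_add +
  assumes scaleC_add_right: "c *\<^sub>C (x + y) = c *\<^sub>C x + c *\<^sub>C y"
    and scaleC_add_left: "(c + d) *\<^sub>C x = c *\<^sub>C x + d *\<^sub>C x"
    and scaleC_scaleC: "c *\<^sub>C (d *\<^sub>C x) = (c * d) *\<^sub>C x"
    and scaleC_one: "1 *\<^sub>C x = x"

class complex_normed_vector = complex_vector + real_normed_vector +
  assumes scaleR_scaleC: "r *\<^sub>R x = complex_of_real r *\<^sub>C x"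
    and norm_scaleC: "norm (c *\<^sub>C x) = cmod c * norm x"

class complex_banach = complex_normed_vector + banach

text \<open>The inner product is linear in the first argument.\<close>

class complex_inner = complex_normed_vector +
  fixes cinner :: "'a \<Rightarrow> 'a \<Rightarrow> complex"
  assumes cinner_commute: "cinner x y = cnj (cinner y x)"
    and cinner_add_left: "cinner (x + y) z = cinner x z + cinner y z"
    and cinner_scaleC_left: "cinner (c *\<^sub>C x) y = c * cinner x y"
    and cinner_norm: "cinner x x = complex_of_real ((norm x)\<^sup>2)"

class complex_hilbert = complex_inner + complete_space

subclass (in complex_hilbert) complex_banach ..

lemma scaleC_zero_right [simp]: "c *\<^sub>C (0 :: 'a :: complex_vector) = 0"
  using scaleC_add_right[of c 0 0] by simp

lemma scaleC_zero_left [simp]: "0 *\<^sub>C (x :: 'a :: complex_vector) = 0"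
  using scaleC_add_left[of 0 0 x] by simp

lemma scaleC_minus_right: "c *\<^sub>C (- x) = - (c *\<^sub>C (x :: 'a :: complex_vector))"
  using scaleC_add_right[of c x "- x"] by (simp add: eq_neg_iff_add_eq_0 add.commute)

lemma scaleC_diff_right: "c *\<^sub>C (x - y) = c *\<^sub>C x - c *\<^sub>C (y :: 'a :: complex_vector)"
  using scaleC_add_right[of c x "- y"] by (simp add: scaleC_minus_right)

lemma scaleC_minus_one: "(- 1) *\<^sub>C x = - (x :: 'a :: complex_vector)"
proof -
  have "(- 1) *\<^sub>C x + x = 0"
    using scaleC_add_left[of "-1" 1 x] by (simp add: scaleC_one)
  then show ?thesis by (simp add: eq_neg_iff_add_eq_0)
qed

lemma bounded_linear_scaleC: "bounded_linear (\<lambda>x :: 'a :: complex_normed_vector. c *\<^sub>C x)"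
  by (rule bounded_linear_intro[where K = "cmod c"])
     (simp_all add: scaleC_add_right scaleR_scaleC scaleC_scaleC norm_scaleC mult.commute)

definition clinear :: "('a::complex_vector \<Rightarrow> 'b::complex_vector) \<Rightarrow> bool" where
  "clinear f \<longleftrightarrow> (\<forall>x y. f (x + y) = f x + f y) \<and> (\<forall>c x. f (c *\<^sub>C x) = c *\<^sub>C f x)"

definition BJ_orthogonal :: "'a::complex_normed_vector \<Rightarrow> 'a \<Rightarrow> bool"  (infix \<open>\<bottom>\<^sub>B\<^sub>J\<close> 50) where
  "u \<bottom>\<^sub>B\<^sub>J v \<longleftrightarrow> (\<forall>\<alpha>. norm (u + \<alpha> *\<^sub>C v) \<ge> norm u)"

instantiation complex :: complex_vector
begin
definition "c *\<^sub>C (x :: complex) = c * x"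
instance by standard (simp_all add: scaleC_complex_def algebra_simps)
end


section \<open>Bounded operators\<close>

typedef (overloaded) 'a bop =
  "{f :: 'a::complex_normed_vector \<Rightarrow>\<^sub>L 'a. \<forall>c x. f (c *\<^sub>C x) = c *\<^sub>C f x}"
  by (rule exI[of _ 0]) simp

setup_lifting type_definition_bop

lift_definition op_apply :: "'a::complex_normed_vector bop \<Rightarrow> 'a \<Rightarrow> 'a" is blinfun_apply .

lemma op_eqI: "(\<And>x. op_apply S x = op_apply T x) \<Longrightarrow> S = T"
  by transfer (rule blinfun_eqI)

lemma op_apply_add: "op_apply T (x + y) = op_apply T x + op_apply T y"
  by transfer (rule blinfun.add_right)

lemma op_apply_scaleC: "op_apply T (c *\<^sub>C x) = c *\<^sub>C op_apply T x"
  by transfer simp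

instantiation bop :: (complex_normed_vector) complex_normed_vector
begin
lift_definition zero_bop :: "'a bop" is 0 by simp
lift_definition plus_bop :: "'a bop \<Rightarrow> 'a bop \<Rightarrow> 'a bop" is "(+)"
  by (simp add: blinfun.add_left scaleC_add_right)
lift_definition minus_bop :: "'a bop \<Rightarrow> 'a bop \<Rightarrow> 'a bop" is "(-)"
  by (simp add: blinfun.diff_left scaleC_diff_right)
lift_definition uminus_bop :: "'a bop \<Rightarrow> 'a bop" is uminus
  by (simp add: blinfun.minus_left scaleC_minus_right)
lift_definition scaleR_bop :: "real \<Rightarrow> 'a bop \<Rightarrow> 'a bop" is scaleR
  by (simp add: blinfun.scaleR_left scaleR_scaleC scaleC_scaleC mult.commute)
lift_definition norm_bop :: "'a bop \<Rightarrow> real" is norm .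
definition dist_bop :: "'a bop \<Rightarrow> 'a bop \<Rightarrow> real" where "dist_bop S T = norm (S - T)"
definition sgn_bop :: "'a bop \<Rightarrow> 'a bop" where "sgn_bop T = inverse (norm T) *\<^sub>R T"
definition uniformity_bop :: "('a bop \<times> 'a bop) filter" where
  "uniformity_bop = (INF e\<in>{0<..}. principal {(S, T). dist S T < e})"
definition open_bop :: "'a bop set \<Rightarrow> bool" where
  "open_bop U = (\<forall>S\<in>U. eventually (\<lambda>(S', T). S' = S \<longrightarrow> T \<in> U) uniformity)"

lemma scaleC_blinfun: "bounded_linear (\<lambda>x. c *\<^sub>C blinfun_apply f (x :: 'a))" for f :: "'a \<Rightarrow>\<^sub>L 'a"
  by (rule bounded_linear_compose[OF bounded_linear_scaleC blinfun.bounded_linear_right])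

lift_definition scaleC_bop :: "complex \<Rightarrow> 'a bop \<Rightarrow> 'a bop"
  is "\<lambda>c f. Blinfun (\<lambda>x. c *\<^sub>C blinfun_apply f x)"
  by (simp add: bounded_linear_Blinfun_apply scaleC_blinfun scaleC_scaleC mult.commute)

lemma op_apply_scaleC_left: "op_apply (c *\<^sub>C T) x = c *\<^sub>C op_apply T x"
  by transfer (simp add: bounded_linear_Blinfun_apply scaleC_blinfun)

lemma op_apply_add_left: "op_apply (S + T) x = op_apply S x + op_apply T x"
  by transfer (simp add: blinfun.add_left)

lemma op_apply_scaleR_left: "op_apply (r *\<^sub>R T) x = r *\<^sub>R op_apply T x"
  by transfer (simp add: blinfun.scaleR_left)

lemma norm_scaleC_bop_le: "norm (c *\<^sub>C T) \<le> cmod c * norm (T :: 'a bop)"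
  by transfer
     (auto intro!: norm_blinfun_bound mult_left_mono norm_blinfun
        simp: bounded_linear_Blinfun_apply scaleC_blinfun norm_scaleC mult.assoc)

instance
proof
  fix S T :: "'a bop" and r :: real and c d :: complex
  show "r *\<^sub>R T = complex_of_real r *\<^sub>C T"
    by (rule op_eqI) (simp add: op_apply_scaleC_left op_apply_scaleR_left scaleR_scaleC)
  show sum: "c *\<^sub>C (S + T) = c *\<^sub>C S + c *\<^sub>C T" "(c + d) *\<^sub>C T = c *\<^sub>C T + d *\<^sub>C T"
    by (rule op_eqI, simp add: op_apply_scaleC_left op_apply_add_left
        scaleC_add_right scaleC_add_left)+
  show ss: "c *\<^sub>C d *\<^sub>C T = (c * d) *\<^sub>C T" for c d and T :: "'a bop"
    by (rule op_eqI) (simp add: op_apply_scaleC_left scaleC_scaleC)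
  show s1: "1 *\<^sub>C T = T" for T :: "'a bop"
    by (rule op_eqI) (simp add: op_apply_scaleC_left scaleC_one)
  have nz: "norm (0 :: 'a bop) = 0"
    by transfer simp
  show "norm (c *\<^sub>C T) = cmod c * norm T"
  proof (cases "c = 0")
    case True
    have "op_apply 0 x = 0" for x :: 'a
      by transfer simp
    then have "0 *\<^sub>C T = 0"
      by (intro op_eqI) (simp add: op_apply_scaleC_left)
    with True nz show ?thesis by simp
  next
    case False
    have "norm T = norm (inverse c *\<^sub>C (c *\<^sub>C T))"
      using False by (simp add: ss s1)
    also have "\<dots> \<le> cmod (inverse c) * norm (c *\<^sub>C T)"
      by (rule norm_scaleC_bop_le)
    finally have "cmod c * norm T \<le> norm (c *\<^sub>C T)"
      using False by (simp add: norm_inverse) (simp add: field_simps)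
    with norm_scaleC_bop_le[of c T] show ?thesis by simp
  qed
  show "uniformity = (INF e\<in>{0<..}. principal {(S, T :: 'a bop). dist S T < e})"
    by (rule uniformity_bop_def)
  show "open U = (\<forall>S\<in>U. eventually (\<lambda>(S', T). S' = S \<longrightarrow> T \<in> U) uniformity)"
    for U :: "'a bop set"
    by (rule open_bop_def)
  show "dist S T = norm (S - T)" "sgn T = inverse (norm T) *\<^sub>R T"
    by (simp_all add: dist_bop_def sgn_bop_def)
qed (transfer; simp add: algebra_simps norm_triangle_ineq)+
end

lemma norm_op_apply: "norm (op_apply T x) \<le> norm T * norm x"
  by transfer (rule norm_blinfun)

instantiation bop :: (complex_normed_vector) times
begin
lift_definition times_bop :: "'a bop \<Rightarrow> 'a bop \<Rightarrow> 'a bop" is "(o\<^sub>L)" by simp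
instance ..
end

lemma op_apply_times: "op_apply (S * T) x = op_apply S (op_apply T x)"
  by transfer simp

definition is_adjoint :: "'a::complex_inner bop \<Rightarrow> 'a bop \<Rightarrow> bool" where
  "is_adjoint S T \<longleftrightarrow> (\<forall>x y. cinner (op_apply T x) y = cinner x (op_apply S y))"

definition rank_one :: "'a::complex_normed_vector bop \<Rightarrow> bool" where
  "rank_one T \<longleftrightarrow> (\<exists>a. a \<noteq> 0 \<and> range (op_apply T) = range (\<lambda>c. c *\<^sub>C a))"


section \<open>The algebraic tensor product\<close>

instantiation poly_mapping :: (type, complex_vector) complex_vector
begin
lift_definition scaleC_poly_mapping :: "complex \<Rightarrow> ('a \<Rightarrow>\<^sub>0 'b) \<Rightarrow> ('a \<Rightarrow>\<^sub>0 'b)"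
  is "\<lambda>c p k. c *\<^sub>C p k"
  by (erule finite_subset[rotated]) auto
instance
  by standard (transfer; simp add: fun_eq_iff scaleC_add_right scaleC_add_left scaleC_scaleC scaleC_one)+
end

text \<open>The free vector space on pairs, and the subspace generated by the bilinearity relations.\<close>

inductive_set bilin_rel :: "(('a::complex_vector \<times> 'b::complex_vector) \<Rightarrow>\<^sub>0 complex) set" where
  add_left: "Poly_Mapping.single (a + a', b) 1 - Poly_Mapping.single (a, b) 1
    - Poly_Mapping.single (a', b) 1 \<in> bilin_rel"
| add_right: "Poly_Mapping.single (a, b + b') 1 - Poly_Mapping.single (a, b) 1
    - Poly_Mapping.single (a, b') 1 \<in> bilin_rel"
| scale_left: "Poly_Mapping.single (c *\<^sub>C a, b) 1 - c *\<^sub>C Poly_Mapping.single (a, b) 1 \<in> bilin_rel"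
| scale_right: "Poly_Mapping.single (a, c *\<^sub>C b) 1 - c *\<^sub>C Poly_Mapping.single (a, b) 1 \<in> bilin_rel"
| sum: "p \<in> bilin_rel \<Longrightarrow> q \<in> bilin_rel \<Longrightarrow> p + q \<in> bilin_rel"
| scale: "p \<in> bilin_rel \<Longrightarrow> c *\<^sub>C p \<in> bilin_rel"

lemma bilin_rel_zero: "0 \<in> bilin_rel"
  using bilin_rel.scale[OF bilin_rel.add_left, of 0] by simp

lemma bilin_rel_uminus: "p \<in> bilin_rel \<Longrightarrow> - p \<in> bilin_rel"
  using bilin_rel.scale[of p "- 1"] by (simp add: scaleC_minus_one)

lemma bilin_rel_equivp: "equivp (\<lambda>p q. p - q \<in> bilin_rel)"
proof (rule equivpI)
  show "reflp (\<lambda>p q. p - q \<in> bilin_rel)"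
    by (rule reflpI) (simp add: bilin_rel_zero)
  show "symp (\<lambda>p q. p - q \<in> bilin_rel)"
    by (rule sympI) (metis bilin_rel_uminus minus_diff_eq)
  show "transp (\<lambda>p q. p - q \<in> bilin_rel)"
    by (rule transpI) (drule (1) bilin_rel.sum, simp)
qed

quotient_type (overloaded) ('a, 'b) tensor =
    "('a::complex_vector \<times> 'b::complex_vector) \<Rightarrow>\<^sub>0 complex" / "\<lambda>p q. p - q \<in> bilin_rel"
  by (rule bilin_rel_equivp)

instantiation tensor :: (complex_vector, complex_vector) complex_vector
begin
lift_definition zero_tensor :: "('a, 'b) tensor" is 0 .
lift_definition plus_tensor :: "('a, 'b) tensor \<Rightarrow> ('a, 'b) tensor \<Rightarrow> ('a, 'b) tensor" is "(+)"
  by (metis bilin_rel.sum add_diff_add)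
lift_definition uminus_tensor :: "('a, 'b) tensor \<Rightarrow> ('a, 'b) tensor" is uminus
  by (metis bilin_rel_uminus minus_diff_minus)
lift_definition minus_tensor :: "('a, 'b) tensor \<Rightarrow> ('a, 'b) tensor \<Rightarrow> ('a, 'b) tensor" is "(-)"
proof -
  fix p p' q q' :: "('a \<times> 'b) \<Rightarrow>\<^sub>0 complex"
  assume "p - p' \<in> bilin_rel" "q - q' \<in> bilin_rel"
  then have "(p - p') + - (q - q') \<in> bilin_rel"
    by (intro bilin_rel.sum bilin_rel_uminus)
  then show "p - q - (p' - q') \<in> bilin_rel"
    by (simp add: algebra_simps)
qed
lift_definition scaleC_tensor :: "complex \<Rightarrow> ('a, 'b) tensor \<Rightarrow> ('a, 'b) tensor" is "(*\<^sub>C)"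
  by (metis bilin_rel.scale scaleC_diff_right)
instance
  by standard (transfer; simp add: bilin_rel_zero scaleC_add_right scaleC_add_left scaleC_scaleC
      scaleC_one algebra_simps)+
end

lift_definition tensor :: "'a::complex_vector \<Rightarrow> 'b::complex_vector \<Rightarrow> ('a, 'b) tensor"
    (infixr \<open>\<otimes>\<close> 70)
  is "\<lambda>a b. Poly_Mapping.single (a, b) 1" .

definition cbilinear ::
    "('a::complex_vector \<Rightarrow> 'b::complex_vector \<Rightarrow> 'c::complex_vector) \<Rightarrow> bool" where
  "cbilinear \<beta> \<longleftrightarrow> (\<forall>b. clinear (\<lambda>a. \<beta> a b)) \<and> (\<forall>a. clinear (\<beta> a))"

lemma cbilinear_tensor: "cbilinear (\<otimes>)"
  unfolding cbilinear_def clinear_def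
  by (intro conjI allI; transfer;
      metis bilin_rel.add_left bilin_rel.add_right bilin_rel.scale_left bilin_rel.scale_right
        diff_diff_eq)

text \<open>The linear map on the tensor product induced by a bilinear map.\<close>

definition tensor_lift ::
    "('a::complex_vector \<Rightarrow> 'b::complex_vector \<Rightarrow> 'c::complex_vector) \<Rightarrow> ('a, 'b) tensor \<Rightarrow> 'c"
  where "tensor_lift \<beta> = (THE F. clinear F \<and> (\<forall>a b. F (a \<otimes> b) = \<beta> a b))"

lemma clinear_zero: "clinear f \<Longrightarrow> f 0 = 0"
  unfolding clinear_def by (metis add_cancel_right_left)

lemma clinear_sum: "clinear f \<Longrightarrow> f (sum g A) = (\<Sum>x\<in>A. f (g x))"
  by (induction A rule: infinite_finite_induct) (simp_all add: clinear_zero, simp add: clinear_def)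

lemma tensor_decomp:
  fixes u :: "('a::complex_vector, 'b::complex_vector) tensor"
  obtains p where "u = (\<Sum>k\<in>Poly_Mapping.keys p. Poly_Mapping.lookup p k *\<^sub>C (fst k \<otimes> snd k))"
proof -
  obtain p where p: "u = abs_tensor p"
    using tensor.abs_induct[of "\<lambda>u. \<exists>p. u = abs_tensor p" u] by blast
  have "p = (\<Sum>k\<in>Poly_Mapping.keys p. Poly_Mapping.lookup p k *\<^sub>C Poly_Mapping.single k 1)"
    by (rule poly_mapping_eqI)
       (simp add: lookup_sum scaleC_poly_mapping.rep_eq lookup_single scaleC_complex_def
         when_def in_keys_iff if_distrib cong: if_cong)
  then have "u = abs_tensor (\<Sum>k\<in>Poly_Mapping.keys p. Poly_Mapping.lookup p k *\<^sub>C Poly_Mapping.single k 1)"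
    using p by simp
  also have "\<dots> = (\<Sum>k\<in>Poly_Mapping.keys p. Poly_Mapping.lookup p k *\<^sub>C (fst k \<otimes> snd k))"
  proof -
    have l: "abs_tensor (p + q) = abs_tensor p + abs_tensor q"
      "abs_tensor (c *\<^sub>C p) = c *\<^sub>C abs_tensor p" for p q :: "('a \<times> 'b) \<Rightarrow>\<^sub>0 complex" and c
      by (simp_all add: plus_tensor.abs_eq scaleC_tensor.abs_eq)
    then have "clinear (abs_tensor :: _ \<Rightarrow> ('a, 'b) tensor)" by (simp add: clinear_def)
    then show ?thesis
      by (simp add: clinear_sum l tensor.abs_eq)
  qed
  finally show ?thesis by (rule that)
qed

lemma tensor_linear_eqI:
  fixes F G :: "('a::complex_vector, 'b::complex_vector) tensor \<Rightarrow> 'c::complex_vector"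
  assumes "clinear F" "clinear G" "\<And>a b. F (a \<otimes> b) = G (a \<otimes> b)"
  shows "F = G"
proof
  fix u :: "('a, 'b) tensor"
  obtain p where u: "u = (\<Sum>k\<in>Poly_Mapping.keys p. Poly_Mapping.lookup p k *\<^sub>C (fst k \<otimes> snd k))"
    by (rule tensor_decomp)
  have "F (c *\<^sub>C (a \<otimes> b)) = G (c *\<^sub>C (a \<otimes> b))" for c a b
    using assms by (simp add: clinear_def)
  then show "F u = G u"
    unfolding u using assms by (simp add: clinear_sum)
qed

lemma tensor_lift_exists:
  assumes \<beta>: "cbilinear \<beta>"
  shows "\<exists>F. clinear F \<and> (\<forall>a b. F (a \<otimes> b) = \<beta> a b)"
proof -
  define G where "G p = (\<Sum>k\<in>Poly_Mapping.keys p. Poly_Mapping.lookup p k *\<^sub>C \<beta> (fst k) (snd k))"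
    for p
  have G: "G p = (\<Sum>k\<in>A. Poly_Mapping.lookup p k *\<^sub>C \<beta> (fst k) (snd k))"
    if "finite A" "Poly_Mapping.keys p \<subseteq> A" for A p
    unfolding G_def using that
    by (intro sum.mono_neutral_left) (auto simp: in_keys_iff)
  have Gadd: "G (p + q) = G p + G q" for p q
  proof -
    let ?A = "Poly_Mapping.keys p \<union> Poly_Mapping.keys q"
    have "G (p + q) = (\<Sum>k\<in>?A. Poly_Mapping.lookup (p + q) k *\<^sub>C \<beta> (fst k) (snd k))"
      by (rule G) (auto simp: Poly_Mapping.keys_add)
    moreover have "G p = (\<Sum>k\<in>?A. Poly_Mapping.lookup p k *\<^sub>C \<beta> (fst k) (snd k))"
      by (rule G) auto
    moreover have "G q = (\<Sum>k\<in>?A. Poly_Mapping.lookup q k *\<^sub>C \<beta> (fst k) (snd k))"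
      by (rule G) auto
    ultimately show ?thesis
      by (simp add: lookup_add scaleC_add_left sum.distrib)
  qed
  have Gscale: "G (c *\<^sub>C p) = c *\<^sub>C G p" for c p
  proof -
    have "G (c *\<^sub>C p) = (\<Sum>k\<in>Poly_Mapping.keys p. Poly_Mapping.lookup (c *\<^sub>C p) k *\<^sub>C \<beta> (fst k) (snd k))"
      by (rule G) (auto simp: in_keys_iff scaleC_poly_mapping.rep_eq)
    moreover have "clinear (\<lambda>x. c *\<^sub>C x :: 'c)"
      by (auto simp: clinear_def scaleC_add_right scaleC_scaleC mult.commute)
    ultimately show ?thesis
      unfolding G_def[of p]
      by (simp add: clinear_sum scaleC_scaleC scaleC_poly_mapping.rep_eq scaleC_complex_def)
  qed
  have lin: "clinear G" using Gadd Gscale by (simp add: clinear_def)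
  have Gdiff: "G (p - q) = G p - G q" for p q
    using Gadd[of "p - q" q] by (simp add: eq_diff_eq)
  have Gs: "G (Poly_Mapping.single (a, b) 1) = \<beta> a b" for a b
    by (subst G[of "{(a, b)}"]) (auto simp: scaleC_one)
  have \<beta>': "\<beta> (a + a') b = \<beta> a b + \<beta> a' b" "\<beta> a (b + b') = \<beta> a b + \<beta> a b'"
    "\<beta> (c *\<^sub>C a) b = c *\<^sub>C \<beta> a b" "\<beta> a (c *\<^sub>C b) = c *\<^sub>C \<beta> a b" for a a' b b' c
    using \<beta> unfolding cbilinear_def clinear_def by blast+
  have null: "G p = 0" if "p \<in> bilin_rel" for p
    using that by (induction) (simp_all add: Gadd Gdiff Gscale Gs \<beta>')
  define F where "F u = G (rep_tensor u)" for u
  have F: "F (abs_tensor p) = G p" for p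
  proof -
    have "p - rep_tensor (abs_tensor p) \<in> bilin_rel"
      by (metis (no_types, lifting) Quotient3_rel_abs Quotient3_tensor bilin_rel_zero
          diff_self rep_abs_rsp)
    from null[OF this] show ?thesis unfolding F_def by (simp add: Gdiff)
  qed
  have "F (u + v) = F u + F v" for u v
    by (induct u rule: tensor.abs_induct, induct v rule: tensor.abs_induct)
       (simp add: F Gadd plus_tensor.abs_eq)
  moreover have "F (c *\<^sub>C u) = c *\<^sub>C F u" for c u
    by (induct u rule: tensor.abs_induct) (simp add: F Gscale scaleC_tensor.abs_eq)
  moreover have "F (a \<otimes> b) = \<beta> a b" for a b
    by (simp add: tensor.abs_eq F Gs)
  ultimately show ?thesis unfolding clinear_def by blast
qed

lemma tensor_lift:
  assumes "cbilinear \<beta>"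
  shows clinear_tensor_lift: "clinear (tensor_lift \<beta>)"
    and tensor_lift_tensor: "tensor_lift \<beta> (a \<otimes> b) = \<beta> a b"
proof -
  have "\<exists>!F. clinear F \<and> (\<forall>a b. F (a \<otimes> b) = \<beta> a b)"
    using tensor_lift_exists[OF assms] tensor_linear_eqI by (metis (mono_tags, lifting))
  from theI'[OF this]
  show "clinear (tensor_lift \<beta>)" "tensor_lift \<beta> (a \<otimes> b) = \<beta> a b"
    unfolding tensor_lift_def by blast+
qed

section \<open>The Hilbert spaces of square-summable families\<close>

typedef 'i ell2 = "{x :: 'i \<Rightarrow> complex. (\<lambda>i. (cmod (x i))\<^sup>2) summable_on UNIV}"
  by (rule exI[of _ "\<lambda>_. 0"]) simp

setup_lifting type_definition_ell2

lift_definition ell2_nth :: "'i ell2 \<Rightarrow> 'i \<Rightarrow> complex" is "\<lambda>x. x" .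

lemma ell2_eqI: "(\<And>i. ell2_nth x i = ell2_nth y i) \<Longrightarrow> x = y"
  by transfer auto

lemma ell2_bound:
  assumes "\<And>F. finite F \<Longrightarrow> L2_set (\<lambda>i. cmod (x i)) F \<le> C"
  shows "(\<lambda>i. (cmod (x i))\<^sup>2) summable_on UNIV"
    and "sqrt (infsum (\<lambda>i. (cmod (x i))\<^sup>2) UNIV) \<le> C"
proof -
  have C: "0 \<le> C" using assms[of "{}"] by simp
  have s: "(\<Sum>i\<in>F. (cmod (x i))\<^sup>2) \<le> C\<^sup>2" if "finite F" for F
    using assms[OF that] C unfolding L2_set_def
    by (metis real_sqrt_le_iff real_sqrt_abs abs_of_nonneg)
  show *: "(\<lambda>i. (cmod (x i))\<^sup>2) summable_on UNIV"
    by (rule nonneg_bdd_above_summable_on) (auto intro!: bdd_aboveI2 s)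
  have "infsum (\<lambda>i. (cmod (x i))\<^sup>2) UNIV \<le> C\<^sup>2"
    by (rule infsum_le_finite_sums[OF *]) (use s in auto)
  then show "sqrt (infsum (\<lambda>i. (cmod (x i))\<^sup>2) UNIV) \<le> C"
    using C by (metis real_sqrt_le_iff real_sqrt_abs abs_of_nonneg)
qed

lemma L2_set_le_infsum:
  assumes "(\<lambda>i. (cmod (x i))\<^sup>2) summable_on UNIV" "finite F"
  shows "L2_set (\<lambda>i. cmod (x i)) F \<le> sqrt (infsum (\<lambda>i. (cmod (x i))\<^sup>2) UNIV)"
  unfolding L2_set_def using assms by (auto intro!: finite_sum_le_infsum)

lemma L2_set_triangle_cmod:
  "L2_set (\<lambda>i. cmod (x i + y i)) F \<le> L2_set (\<lambda>i. cmod (x i)) F + L2_set (\<lambda>i. cmod (y i)) F"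
  by (rule order_trans[OF L2_set_mono L2_set_triangle_ineq]) (auto intro: norm_triangle_ineq)

lemma ell2_add_bound:
  assumes "(\<lambda>i. (cmod (x i))\<^sup>2) summable_on UNIV" "(\<lambda>i. (cmod (y i))\<^sup>2) summable_on UNIV"
    and "finite F"
  shows "L2_set (\<lambda>i. cmod (x i + y i)) F \<le>
    sqrt (infsum (\<lambda>i. (cmod (x i))\<^sup>2) UNIV) + sqrt (infsum (\<lambda>i. (cmod (y i))\<^sup>2) UNIV)"
  using L2_set_triangle_cmod[of x y F] L2_set_le_infsum[OF assms(1,3)]
    L2_set_le_infsum[OF assms(2,3)] by linarith

lemma ell2_summable_scale:
  "(\<lambda>i. (cmod (x i))\<^sup>2) summable_on UNIV \<Longrightarrow> (\<lambda>i. (cmod (c * x i))\<^sup>2) summable_on UNIV"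
  by (simp add: norm_mult power_mult_distrib summable_on_cmult_right)

lemma ell2_summable_product:
  assumes "(\<lambda>i. (cmod (x i))\<^sup>2) summable_on UNIV" "(\<lambda>i. (cmod (y i))\<^sup>2) summable_on UNIV"
  shows "(\<lambda>i. x i * cnj (y i)) summable_on UNIV"
  by (rule abs_summable_summable, rule abs_summable_product)
     (use assms in \<open>simp_all add: norm_mult power2_eq_square\<close>)

instantiation ell2 :: (type) complex_inner
begin
lift_definition zero_ell2 :: "'a ell2" is "\<lambda>_. 0" by simp
lift_definition plus_ell2 :: "'a ell2 \<Rightarrow> 'a ell2 \<Rightarrow> 'a ell2" is "\<lambda>x y i. x i + y i"
  by (rule ell2_bound(1), rule ell2_add_bound)
lift_definition uminus_ell2 :: "'a ell2 \<Rightarrow> 'a ell2" is "\<lambda>x i. - x i" by simp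
definition minus_ell2 :: "'a ell2 \<Rightarrow> 'a ell2 \<Rightarrow> 'a ell2" where "minus_ell2 x y = x + - y"
lift_definition scaleC_ell2 :: "complex \<Rightarrow> 'a ell2 \<Rightarrow> 'a ell2" is "\<lambda>c x i. c * x i"
  by (rule ell2_summable_scale)
definition scaleR_ell2 :: "real \<Rightarrow> 'a ell2 \<Rightarrow> 'a ell2" where
  "scaleR_ell2 r x = complex_of_real r *\<^sub>C x"
lift_definition norm_ell2 :: "'a ell2 \<Rightarrow> real"
  is "\<lambda>x. sqrt (infsum (\<lambda>i. (cmod (x i))\<^sup>2) UNIV)" .
lift_definition cinner_ell2 :: "'a ell2 \<Rightarrow> 'a ell2 \<Rightarrow> complex"
  is "\<lambda>x y. infsum (\<lambda>i. x i * cnj (y i)) UNIV" .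
definition dist_ell2 :: "'a ell2 \<Rightarrow> 'a ell2 \<Rightarrow> real" where "dist_ell2 x y = norm (x - y)"
definition sgn_ell2 :: "'a ell2 \<Rightarrow> 'a ell2" where "sgn_ell2 x = inverse (norm x) *\<^sub>R x"
definition uniformity_ell2 :: "('a ell2 \<times> 'a ell2) filter" where
  "uniformity_ell2 = (INF e\<in>{0<..}. principal {(x, y). dist x y < e})"
definition open_ell2 :: "'a ell2 set \<Rightarrow> bool" where
  "open_ell2 U = (\<forall>x\<in>U. eventually (\<lambda>(x', y). x' = x \<longrightarrow> y \<in> U) uniformity)"

lemma ell2_nth_simps [simp]:
  "ell2_nth 0 i = 0" "ell2_nth (x + y) i = ell2_nth x i + ell2_nth y i"
  "ell2_nth (- x) i = - ell2_nth x i" "ell2_nth (x - y) i = ell2_nth x i - ell2_nth y i"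
  "ell2_nth (c *\<^sub>C x) i = c * ell2_nth x i"
  unfolding minus_ell2_def by (transfer; simp)+

lemma L2_set_le_norm: "finite F \<Longrightarrow> L2_set (\<lambda>i. cmod (ell2_nth x i)) F \<le> norm x"
  by transfer (rule L2_set_le_infsum)

lemma ell2_norm_bound:
  "(\<And>F. finite F \<Longrightarrow> L2_set (\<lambda>i. cmod (ell2_nth x i)) F \<le> C) \<Longrightarrow> norm x \<le> C"
  by transfer (rule ell2_bound(2))

lemma cmod_ell2_nth_le: "cmod (ell2_nth x i) \<le> norm x"
  using L2_set_le_norm[of "{i}" x] by simp

instance
proof
  fix x y z :: "'a ell2" and r s :: real and c d :: complex
  show "x + y + z = x + (y + z)" "x + y = y + x" "0 + x = x" "- x + x = 0" "x - y = x + - y"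
    "c *\<^sub>C (x + y) = c *\<^sub>C x + c *\<^sub>C y" "(c + d) *\<^sub>C x = c *\<^sub>C x + d *\<^sub>C x"
    "c *\<^sub>C d *\<^sub>C x = (c * d) *\<^sub>C x" "1 *\<^sub>C x = x"
    by (rule ell2_eqI, simp add: algebra_simps)+
  show "r *\<^sub>R (x + y) = r *\<^sub>R x + r *\<^sub>R y" "(r + s) *\<^sub>R x = r *\<^sub>R x + s *\<^sub>R x"
    "r *\<^sub>R s *\<^sub>R x = (r * s) *\<^sub>R x" "1 *\<^sub>R x = x"
    unfolding scaleR_ell2_def by (rule ell2_eqI, simp add: algebra_simps)+
  show "r *\<^sub>R x = complex_of_real r *\<^sub>C x"
    by (simp add: scaleR_ell2_def)
  show "dist x y = norm (x - y)" "sgn x = inverse (norm x) *\<^sub>R x"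
    by (simp_all add: dist_ell2_def sgn_ell2_def)
  show "uniformity = (INF e\<in>{0<..}. principal {(x, y :: 'a ell2). dist x y < e})"
    by (rule uniformity_ell2_def)
  show "open U = (\<forall>x\<in>U. eventually (\<lambda>(x', y). x' = x \<longrightarrow> y \<in> U) uniformity)"
    for U :: "'a ell2 set"
    by (rule open_ell2_def)
  show "norm (x + y) \<le> norm x + norm y"
    by transfer (rule ell2_bound(2), rule ell2_add_bound)
  show nC: "norm (c *\<^sub>C x) = cmod c * norm x" for c and x :: "'a ell2"
    by transfer (simp add: norm_mult power_mult_distrib infsum_cmult_right' real_sqrt_mult)
  show "norm (r *\<^sub>R x) = \<bar>r\<bar> * norm x"
    by (simp add: scaleR_ell2_def nC)
  show "(norm x = 0) = (x = 0)"
  proof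
    assume "norm x = 0"
    then have "ell2_nth x i = 0" for i using cmod_ell2_nth_le[of x i] by simp
    then show "x = 0" by (intro ell2_eqI) simp
  next
    show "x = 0 \<Longrightarrow> norm x = 0" by transfer simp
  qed
  show "cinner x y = cnj (cinner y x)"
    by transfer (simp flip: infsum_cnj add: mult.commute)
  show "cinner (x + y) z = cinner x z + cinner y z"
    by transfer (simp add: distrib_right infsum_add ell2_summable_product)
  show "cinner (c *\<^sub>C x) y = c * cinner x y"
    by transfer (simp add: infsum_cmult_right' mult.assoc)
  show "cinner x x = complex_of_real ((norm x)\<^sup>2)"
  proof (transfer, goal_cases)
    case (1 x)
    have "((\<lambda>i. complex_of_real ((cmod (x i))\<^sup>2)) has_sum
        complex_of_real (infsum (\<lambda>i. (cmod (x i))\<^sup>2) UNIV)) UNIV"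
      using 1 by (intro has_sum_of_real) simp
    then have "infsum (\<lambda>i. x i * cnj (x i)) UNIV = complex_of_real (infsum (\<lambda>i. (cmod (x i))\<^sup>2) UNIV)"
      by (intro infsumI) (simp only: complex_norm_square)
    moreover have "0 \<le> infsum (\<lambda>i. (cmod (x i))\<^sup>2) UNIV"
      by (rule infsum_nonneg) simp
    ultimately show ?case by simp
  qed
qed
end

instance ell2 :: (type) complex_hilbert
proof
  fix X :: "nat \<Rightarrow> 'a ell2"
  assume X: "Cauchy X"
  have c: "Cauchy (\<lambda>n. ell2_nth (X n) i)" for i
  proof (rule metric_CauchyI)
    fix e :: real assume "0 < e"
    then obtain M where "\<forall>m\<ge>M. \<forall>n\<ge>M. dist (X m) (X n) < e"
      using metric_CauchyD[OF X] by blast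
    moreover have "dist (ell2_nth (X m) i) (ell2_nth (X n) i) \<le> dist (X m) (X n)" for m n
      using cmod_ell2_nth_le[of "X m - X n" i] by (simp add: dist_norm)
    ultimately show "\<exists>M. \<forall>m\<ge>M. \<forall>n\<ge>M. dist (ell2_nth (X m) i) (ell2_nth (X n) i) < e"
      by (meson le_less_trans)
  qed
  define l where "l i = lim (\<lambda>n. ell2_nth (X n) i)" for i
  have l: "(\<lambda>n. ell2_nth (X n) i) \<longlonglongrightarrow> l i" for i
    unfolding l_def using c[of i] by (simp add: Cauchy_convergent_iff convergent_LIMSEQ_iff)
  have bound: "L2_set (\<lambda>i. cmod (ell2_nth (X m) i - l i)) F \<le> e"
    if "finite F" and e: "\<forall>n\<ge>M. norm (X m - X n) \<le> e" for F m M and e :: real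
  proof (rule LIMSEQ_le_const2)
    show "(\<lambda>n. L2_set (\<lambda>i. cmod (ell2_nth (X m) i - ell2_nth (X n) i)) F)
        \<longlonglongrightarrow> L2_set (\<lambda>i. cmod (ell2_nth (X m) i - l i)) F"
      unfolding L2_set_def by (intro tendsto_intros l)
    show "\<exists>N. \<forall>n\<ge>N. L2_set (\<lambda>i. cmod (ell2_nth (X m) i - ell2_nth (X n) i)) F \<le> e"
      using L2_set_le_norm[OF that(1), of "X m - X _"] e by (intro exI[of _ M]) (auto intro: order_trans)
  qed
  have M: "\<exists>M. \<forall>m\<ge>M. \<forall>n\<ge>M. norm (X m - X n) \<le> e" if "0 < e" for e
    using metric_CauchyD[OF X that] unfolding dist_norm by (meson less_imp_le)
  obtain M1 where M1: "\<forall>m\<ge>M1. \<forall>n\<ge>M1. norm (X m - X n) \<le> 1" using M[of 1] by auto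
  have "(\<lambda>i. (cmod (l i))\<^sup>2) summable_on UNIV"
  proof (rule ell2_bound(1))
    fix F :: "'a set" assume F: "finite F"
    have "L2_set (\<lambda>i. cmod (l i)) F
        = L2_set (\<lambda>i. cmod (ell2_nth (X M1) i + (l i - ell2_nth (X M1) i))) F"
      by simp
    also have "\<dots> \<le> L2_set (\<lambda>i. cmod (ell2_nth (X M1) i)) F
        + L2_set (\<lambda>i. cmod (l i - ell2_nth (X M1) i)) F"
      by (rule L2_set_triangle_cmod)
    also have "\<dots> \<le> norm (X M1) + 1"
      using L2_set_le_norm[OF F, of "X M1"] bound[OF F, of M1 M1 1] M1
      by (simp add: norm_minus_commute)
    finally show "L2_set (\<lambda>i. cmod (l i)) F \<le> norm (X M1) + 1" .
  qed
  then obtain L where L: "ell2_nth L = l"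
    by (metis Abs_ell2_inverse ell2_nth.rep_eq mem_Collect_eq)
  have "X \<longlonglongrightarrow> L"
  proof (rule metric_LIMSEQ_I)
    fix e :: real assume "0 < e"
    then obtain M where "\<forall>m\<ge>M. \<forall>n\<ge>M. norm (X m - X n) \<le> e / 2"
      using M[of "e / 2"] by auto
    then have "norm (X m - L) \<le> e / 2" if "m \<ge> M" for m
      using that by (intro ell2_norm_bound) (unfold ell2_nth_simps L, rule bound, auto)
    then show "\<exists>M. \<forall>m\<ge>M. dist (X m) L < e"
      using \<open>0 < e\<close> by (intro exI[of _ M]) (fastforce simp: dist_norm)
  qed
  then show "convergent X" by (auto simp: convergent_def)
qed

lift_definition ell2_tensor :: "'i ell2 \<Rightarrow> 'j ell2 \<Rightarrow> ('i \<times> 'j) ell2" 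
  is "\<lambda>x y (i, j). x i * y j"
proof -
  fix x :: "'i \<Rightarrow> complex" and y :: "'j \<Rightarrow> complex"
  assume x: "(\<lambda>i. (cmod (x i))\<^sup>2) summable_on UNIV" and y: "(\<lambda>i. (cmod (y i))\<^sup>2) summable_on UNIV"
  let ?X = "infsum (\<lambda>i. (cmod (x i))\<^sup>2) UNIV" and ?Y = "infsum (\<lambda>i. (cmod (y i))\<^sup>2) UNIV"
  let ?f = "\<lambda>k. (cmod (case k of (i, j) \<Rightarrow> x i * y j))\<^sup>2"
  have "sum ?f F \<le> ?X * ?Y" if F: "finite F" for F
  proof -
    have "sum ?f F \<le> sum ?f (fst ` F \<times> snd ` F)"
      using F by (intro sum_mono2) (auto simp: rev_image_eqI)
    also have "\<dots> = (\<Sum>i\<in>fst ` F. (cmod (x i))\<^sup>2) * (\<Sum>j\<in>snd ` F. (cmod (y j))\<^sup>2)"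
      by (simp add: sum_product sum.cartesian_product norm_mult power_mult_distrib case_prod_unfold)
    also have "\<dots> \<le> ?X * ?Y"
      using F x y by (intro mult_mono finite_sum_le_infsum sum_nonneg infsum_nonneg) auto
    finally show ?thesis .
  qed
  then show "?f summable_on UNIV"
    by (intro nonneg_bdd_above_summable_on) (auto intro!: bdd_aboveI2)
qed

lemma ell2_nth_tensor [simp]: "ell2_nth (ell2_tensor x y) (i, j) = ell2_nth x i * ell2_nth y j"
  by transfer simp

text \<open>
  The space \<open>('i \<times> 'j) ell2\<close> with the elementary tensors \<open>(x \<otimes> y) (i, j) = x i * y j\<close> is the Hilbert
  space tensor product of \<open>'i ell2\<close> and \<open>'j ell2\<close>. The operator \<open>S \<otimes> T\<close> on it is the unique bounded
  operator mapping \<open>x \<otimes> y\<close> to \<open>S x \<otimes> T y\<close>.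
\<close>

definition op_tensor :: "'i ell2 bop \<Rightarrow> 'j ell2 bop \<Rightarrow> ('i \<times> 'j) ell2 bop" where
  "op_tensor S T = (THE R. \<forall>x y. op_apply R (ell2_tensor x y) = ell2_tensor (op_apply S x) (op_apply T y))"

lemma bop_exists:
  fixes f :: "'a::complex_normed_vector \<Rightarrow> 'a"
  assumes "clinear f" "\<And>x. norm (f x) \<le> C * norm x"
  shows "\<exists>T. op_apply T = f"
proof -
  have bl: "bounded_linear f"
    by (rule bounded_linear_intro[where K = C])
       (use assms in \<open>auto simp: clinear_def scaleR_scaleC mult.commute\<close>)
  have "op_apply (Abs_bop (Blinfun f)) = f"
    by (subst op_apply.rep_eq, subst Abs_bop_inverse)
       (use assms in \<open>auto simp: bounded_linear_Blinfun_apply[OF bl] clinear_def\<close>)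
  then show ?thesis by blast
qed

lemma ell2_prod_eqI: "(\<And>i j. ell2_nth x (i, j) = ell2_nth y (i, j)) \<Longrightarrow> x = y"
  by (rule ell2_eqI) (metis surj_pair)

lemma ell2_tensor_bilinear:
  "ell2_tensor (x + x') y = ell2_tensor x y + ell2_tensor x' y"
  "ell2_tensor x (y + y') = ell2_tensor x y + ell2_tensor x y'"
  "ell2_tensor (c *\<^sub>C x) y = c *\<^sub>C ell2_tensor x y"
  "ell2_tensor x (c *\<^sub>C y) = c *\<^sub>C ell2_tensor x y"
  by (rule ell2_prod_eqI, simp add: algebra_simps)+

lift_definition ell2_swap :: "('i \<times> 'j) ell2 \<Rightarrow> ('j \<times> 'i) ell2" is "\<lambda>z (j, i). z (i, j)"
proof -
  fix z :: "'i \<times> 'j \<Rightarrow> complex"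
  assume "(\<lambda>k. (cmod (z k))\<^sup>2) summable_on UNIV"
  then have "((\<lambda>k. (cmod (z k))\<^sup>2) \<circ> prod.swap) summable_on UNIV"
    by (subst summable_on_reindex[symmetric]) auto
  then show "(\<lambda>k. (cmod (case k of (j, i) \<Rightarrow> z (i, j)))\<^sup>2) summable_on UNIV"
    by (simp add: o_def case_prod_unfold prod.swap_def)
qed

lemma ell2_nth_swap [simp]: "ell2_nth (ell2_swap z) (j, i) = ell2_nth z (i, j)"
  by transfer simp

lemma norm_ell2_swap: "norm (ell2_swap z) = norm z"
proof (transfer, goal_cases)
  case (1 z)
  have "infsum (\<lambda>k. (cmod (z k))\<^sup>2) UNIV = infsum ((\<lambda>k. (cmod (z k))\<^sup>2) \<circ> prod.swap) UNIV"
    using infsum_reindex[of prod.swap UNIV "\<lambda>k. (cmod (z k))\<^sup>2"] by simp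
  then show ?case by (simp add: o_def case_prod_unfold prod.swap_def)
qed

lift_definition ell2_row :: "('i \<times> 'j) ell2 \<Rightarrow> 'i \<Rightarrow> 'j ell2" is "\<lambda>z i j. z (i, j)"
proof -
  fix z :: "'i \<times> 'j \<Rightarrow> complex" and i
  assume "(\<lambda>k. (cmod (z k))\<^sup>2) summable_on UNIV"
  then have "(\<lambda>k. (cmod (z k))\<^sup>2) summable_on (range (Pair i))"
    by (rule summable_on_subset_banach) simp
  then show "(\<lambda>j. (cmod (z (i, j)))\<^sup>2) summable_on UNIV"
    by (subst (asm) summable_on_reindex) (auto simp: o_def inj_on_def)
qed

lemma ell2_nth_row [simp]: "ell2_nth (ell2_row z i) j = ell2_nth z (i, j)"
  by transfer simp

lemma norm_ell2_square: "(norm x)\<^sup>2 = infsum (\<lambda>i. (cmod (ell2_nth x i))\<^sup>2) UNIV"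
  by transfer (simp add: infsum_nonneg)

lemma ell2_summable: "(\<lambda>i. (cmod (ell2_nth x i))\<^sup>2) summable_on UNIV"
  by transfer

lemma sum_norm_row:
  assumes "finite A"
  shows "(\<Sum>i\<in>A. (norm (ell2_row z i))\<^sup>2) \<le> (norm z)\<^sup>2"
proof -
  let ?f = "\<lambda>k. (cmod (ell2_nth z k))\<^sup>2"
  have s: "?f summable_on (A \<times> UNIV)"
    by (rule summable_on_subset_banach[OF ell2_summable]) simp
  have "(\<Sum>i\<in>A. (norm (ell2_row z i))\<^sup>2) = (\<Sum>i\<in>A. infsum (\<lambda>j. ?f (i, j)) UNIV)"
    by (simp add: norm_ell2_square)
  also have "\<dots> = infsum (\<lambda>i. infsum (\<lambda>j. ?f (i, j)) UNIV) A"
    using assms by simp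
  also have "\<dots> = infsum ?f (A \<times> UNIV)"
    using infsum_Sigma'_banach[of "\<lambda>i j. ?f (i, j)" A "\<lambda>_. UNIV"] s
    by (simp add: case_prod_unfold)
  also have "\<dots> \<le> infsum ?f UNIV"
    by (rule infsum_mono2[OF s ell2_summable]) auto
  finally show ?thesis by (simp add: norm_ell2_square)
qed

lemma op_tensor_right:
  fixes T :: "'j ell2 bop"
  shows "\<exists>R :: ('i \<times> 'j) ell2 bop. \<forall>z i. ell2_row (op_apply R z) i = op_apply T (ell2_row z i)"
proof -
  let ?g = "\<lambda>z (i :: 'i, j :: 'j). ell2_nth (op_apply T (ell2_row z i)) j"
  have bound: "L2_set (\<lambda>k. cmod (?g z k)) F \<le> norm T * norm z" if F: "finite F" for F z
  proof -
    let ?A = "fst ` F" and ?B = "snd ` F"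
    have "(\<Sum>k\<in>F. (cmod (?g z k))\<^sup>2) \<le> (\<Sum>k\<in>?A \<times> ?B. (cmod (?g z k))\<^sup>2)"
      using F by (intro sum_mono2) (auto simp: rev_image_eqI)
    also have "\<dots> = (\<Sum>i\<in>?A. \<Sum>j\<in>?B. (cmod (ell2_nth (op_apply T (ell2_row z i)) j))\<^sup>2)"
      by (simp add: sum.cartesian_product case_prod_unfold)
    also have "\<dots> \<le> (\<Sum>i\<in>?A. (norm (op_apply T (ell2_row z i)))\<^sup>2)"
      using F unfolding norm_ell2_square
      by (intro sum_mono finite_sum_le_infsum ell2_summable) auto
    also have "\<dots> \<le> (\<Sum>i\<in>?A. (norm T)\<^sup>2 * (norm (ell2_row z i))\<^sup>2)"
      unfolding power_mult_distrib[symmetric]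
      by (intro sum_mono power_mono norm_op_apply) auto
    also have "\<dots> \<le> (norm T)\<^sup>2 * (norm z)\<^sup>2"
      unfolding sum_distrib_left[symmetric]
      using F by (intro mult_left_mono sum_norm_row) auto
    also have "\<dots> = (norm T * norm z)\<^sup>2" by (simp add: power_mult_distrib)
    finally show ?thesis unfolding L2_set_def by (intro real_le_lsqrt) (auto intro: sum_nonneg)
  qed
  have "\<exists>f. \<forall>z k. ell2_nth (f z) k = ?g z k"
  proof -
    have "\<exists>w. \<forall>k. ell2_nth w k = ?g z k" for z
      by (rule exI[of _ "Abs_ell2 (?g z)"])
         (subst ell2_nth.rep_eq, subst Abs_ell2_inverse, auto intro!: ell2_bound(1) bound)
    then show ?thesis by metis
  qed
  then obtain f where "\<forall>z k. ell2_nth (f z) k = ?g z k" by blast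
  then have f: "ell2_nth (f z) (i, j) = ell2_nth (op_apply T (ell2_row z i)) j" for z i j
    by simp
  have row: "ell2_row (x + y) i = ell2_row x i + ell2_row y i"
    "ell2_row (c *\<^sub>C x) i = c *\<^sub>C ell2_row x i" for x y :: "('i \<times> 'j) ell2" and c i
    by (rule ell2_eqI, simp)+
  have "clinear f"
    unfolding clinear_def
    by (intro conjI allI; rule ell2_eqI)
       (auto simp: f row op_apply_add op_apply_scaleC)
  moreover have "norm (f z) \<le> norm T * norm z" for z
  proof (rule ell2_norm_bound)
    fix F :: "('i \<times> 'j) set" assume "finite F"
    have "ell2_nth (f z) k = ?g z k" for k by (cases k) (simp add: f)
    then show "L2_set (\<lambda>k. cmod (ell2_nth (f z) k)) F \<le> norm T * norm z"
      using bound[OF \<open>finite F\<close>, of z] by simp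
  qed
  ultimately obtain R where "op_apply R = f" using bop_exists by blast
  then have "ell2_row (op_apply R z) i = op_apply T (ell2_row z i)" for z i
    by (intro ell2_eqI) (simp add: f)
  then show ?thesis by blast
qed

lemma op_tensor_exists:
  fixes S :: "'i ell2 bop" and T :: "'j ell2 bop"
  shows "\<exists>R. \<forall>x y. op_apply R (ell2_tensor x y) = ell2_tensor (op_apply S x) (op_apply T y)"
proof -
  obtain R :: "('i \<times> 'j) ell2 bop"
    where R: "\<And>z i. ell2_row (op_apply R z) i = op_apply T (ell2_row z i)"
    using op_tensor_right[of T] by blast
  obtain Q :: "('j \<times> 'i) ell2 bop"
    where Q: "\<And>z j. ell2_row (op_apply Q z) j = op_apply S (ell2_row z j)"
    using op_tensor_right[of S] by blast
  define f where "f z = ell2_swap (op_apply Q (ell2_swap (op_apply R z)))" for z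
  have sw: "ell2_swap (x + y) = ell2_swap x + ell2_swap y"
    "ell2_swap (c *\<^sub>C x) = c *\<^sub>C ell2_swap x" for x y :: "('k \<times> 'l) ell2" and c
    by (rule ell2_prod_eqI, simp)+
  have swt: "ell2_swap (ell2_tensor x y) = ell2_tensor y x" for x :: "'k ell2" and y :: "'l ell2"
    by (rule ell2_prod_eqI) (simp add: mult.commute)
  have row: "ell2_row (ell2_tensor x y) i = ell2_nth x i *\<^sub>C y" for x :: "'k ell2" and y :: "'l ell2" and i
    by (rule ell2_eqI) simp
  have eq: "z = ell2_tensor x (op_apply U y)"
    if "\<And>i. ell2_row z i = op_apply U (ell2_row (ell2_tensor x y) i)"
    for z :: "('k \<times> 'l) ell2" and x y U
  proof (rule ell2_prod_eqI)
    fix i j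
    have "ell2_nth z (i, j) = ell2_nth (ell2_row z i) j" by simp
    also have "\<dots> = ell2_nth (ell2_tensor x (op_apply U y)) (i, j)"
      unfolding that row op_apply_scaleC by simp
    finally show "ell2_nth z (i, j) = ell2_nth (ell2_tensor x (op_apply U y)) (i, j)" .
  qed
  have "clinear f"
    by (simp add: clinear_def f_def sw op_apply_add op_apply_scaleC)
  moreover have "norm (f z) \<le> (norm Q * norm R) * norm z" for z
  proof -
    have "norm (f z) \<le> norm Q * norm (op_apply R z)"
      using norm_op_apply[of Q "ell2_swap (op_apply R z)"] by (simp add: f_def norm_ell2_swap)
    also have "\<dots> \<le> norm Q * (norm R * norm z)"
      by (intro mult_left_mono norm_op_apply) simp
    finally show ?thesis by (simp add: mult.assoc)
  qed
  ultimately obtain P where P: "op_apply P = f" using bop_exists by blast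
  have "op_apply P (ell2_tensor x y) = ell2_tensor (op_apply S x) (op_apply T y)" for x y
    unfolding P f_def using eq[OF R] eq[OF Q] swt by metis
  then show ?thesis by blast
qed

lift_definition ell2_ket :: "'i \<Rightarrow> 'i ell2" is "\<lambda>i j. of_bool (i = j)"
proof -
  fix i :: 'i
  have "(\<lambda>j. (cmod (of_bool (i = j)))\<^sup>2) summable_on {i}" by simp
  then show "(\<lambda>j. (cmod (of_bool (i = j)))\<^sup>2) summable_on UNIV"
    by (rule summable_on_cong_neutral[THEN iffD1, rotated -1]) auto
qed

lemma ell2_nth_ket [simp]: "ell2_nth (ell2_ket i) j = of_bool (i = j)"
  by transfer simp

lemma ell2_ket_dense:
  fixes x :: "'i ell2"
  assumes "0 < e"
  shows "\<exists>F. finite F \<and> norm (x - (\<Sum>i\<in>F. ell2_nth x i *\<^sub>C ell2_ket i)) \<le> e"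
proof -
  let ?f = "\<lambda>i. (cmod (ell2_nth x i))\<^sup>2"
  obtain F where F: "finite F" "dist (sum ?f F) (infsum ?f UNIV) \<le> e\<^sup>2"
    using has_sum_finite_approximation[OF has_sum_infsum[OF ell2_summable], of "e\<^sup>2" x] assms by auto
  have cl: "clinear (\<lambda>x. ell2_nth x j)" for j :: 'i
    by (simp add: clinear_def scaleC_complex_def)
  have nth: "ell2_nth (x - (\<Sum>i\<in>F. ell2_nth x i *\<^sub>C ell2_ket i)) j = (if j \<in> F then 0 else ell2_nth x j)" for j
    using F(1) by (simp add: clinear_sum[OF cl] of_bool_def if_distrib cong: if_cong)
  have "norm (x - (\<Sum>i\<in>F. ell2_nth x i *\<^sub>C ell2_ket i)) \<le> e"
  proof (rule ell2_norm_bound)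
    fix G :: "'i set" assume G: "finite G"
    have "(\<Sum>j\<in>G. (cmod (if j \<in> F then 0 else ell2_nth x j))\<^sup>2) = sum ?f (G - F)"
      using G by (intro sum.mono_neutral_cong_right) auto
    also have "\<dots> = sum ?f (F \<union> G) - sum ?f F"
      using F(1) G by (subst sum_diff[symmetric]) (auto intro: sum.cong)
    also have "sum ?f (F \<union> G) \<le> infsum ?f UNIV"
      using F(1) G by (intro finite_sum_le_infsum ell2_summable) auto
    finally have "(\<Sum>j\<in>G. (cmod (if j \<in> F then 0 else ell2_nth x j))\<^sup>2) \<le> e\<^sup>2"
      using F(2) by (simp add: dist_real_def)
    then show "L2_set (\<lambda>i. cmod (ell2_nth (x - (\<Sum>i\<in>F. ell2_nth x i *\<^sub>C ell2_ket i)) i)) G \<le> e"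
      unfolding nth L2_set_def using assms by (intro real_le_lsqrt) auto
  qed
  with F(1) show ?thesis by blast
qed

lemma bop_ket_eqI:
  fixes R Q :: "'i ell2 bop"
  assumes "\<And>i. op_apply R (ell2_ket i) = op_apply Q (ell2_ket i)"
  shows "R = Q"
proof (rule op_eqI)
  fix x
  define D where "D = R + (- 1) *\<^sub>C Q"
  have D: "op_apply D x = op_apply R x - op_apply Q x" for x
    unfolding D_def op_apply_add_left op_apply_scaleC_left by (subst scaleC_minus_one) simp
  have cl: "clinear (op_apply D)"
    by (simp add: clinear_def op_apply_add op_apply_scaleC)
  have "norm (op_apply D x) \<le> 0 + e" if "0 < e" for e
  proof -
    have "0 < e / (norm D + 1)" using that by (simp add: add_nonneg_pos)
    then obtain F where F: "norm (x - (\<Sum>i\<in>F. ell2_nth x i *\<^sub>C ell2_ket i)) \<le> e / (norm D + 1)"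
      (is "norm (x - ?y) \<le> _")
      using ell2_ket_dense by blast
    have "op_apply D ?y = 0"
      by (simp add: clinear_sum[OF cl] op_apply_scaleC D[of "ell2_ket _"] assms)
    then have "op_apply D x = op_apply D (x - ?y)"
      using op_apply_add[of D "x - ?y" ?y] by simp
    then have "norm (op_apply D x) \<le> norm D * norm (x - ?y)"
      using norm_op_apply[of D] by simp
    also have "\<dots> \<le> norm D * (e / (norm D + 1))"
      by (intro mult_left_mono F) simp
    also have "\<dots> \<le> e"
      using that by (simp add: field_simps add_pos_nonneg)
    finally show ?thesis by simp
  qed
  then have "norm (op_apply D x) \<le> 0" by (rule field_le_epsilon)
  then show "op_apply R x = op_apply Q x" by (simp add: D)
qed

lemma op_tensor_unique:
  assumes "\<And>x y. op_apply R (ell2_tensor x y) = op_apply Q (ell2_tensor x y)"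
  shows "R = Q"
proof (rule bop_ket_eqI)
  fix k :: "'a \<times> 'b"
  have "ell2_ket k = ell2_tensor (ell2_ket (fst k)) (ell2_ket (snd k))"
    by (rule ell2_prod_eqI) (auto simp: prod_eq_iff)
  then show "op_apply R (ell2_ket k) = op_apply Q (ell2_ket k)"
    using assms by simp
qed

lemma op_apply_op_tensor:
  "op_apply (op_tensor S T) (ell2_tensor x y) = ell2_tensor (op_apply S x) (op_apply T y)"
proof -
  have "\<exists>!R. \<forall>x y. op_apply R (ell2_tensor x y) = ell2_tensor (op_apply S x) (op_apply T y)"
    using op_tensor_exists[of S T] op_tensor_unique by metis
  from theI'[OF this] show ?thesis unfolding op_tensor_def by blast
qed

lemma cbilinear_op_tensor: "cbilinear op_tensor"
  unfolding cbilinear_def clinear_def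
  by (intro conjI allI; rule op_tensor_unique)
     (simp_all add: op_apply_op_tensor op_apply_add_left op_apply_scaleC_left ell2_tensor_bilinear)


section \<open>The minimal tensor product\<close>

text \<open>Representations may be degenerate. The condition on adjoints says \<open>\<pi> (T\<^sup>*) = (\<pi> T)\<^sup>*\<close>.\<close>

definition is_representation :: "('a::complex_hilbert bop \<Rightarrow> 'k::complex_hilbert bop) \<Rightarrow> bool" where
  "is_representation \<pi> \<longleftrightarrow> clinear \<pi>
    \<and> (\<forall>S T. \<pi> (S * T) = \<pi> S * \<pi> T)
    \<and> (\<forall>S T. is_adjoint S T \<longrightarrow> is_adjoint (\<pi> S) (\<pi> T))"

definition rep_tensor_product ::
    "('a::complex_hilbert bop \<Rightarrow> 'i ell2 bop) \<Rightarrow> ('b::complex_hilbert bop \<Rightarrow> 'j ell2 bop)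
      \<Rightarrow> ('a bop, 'b bop) tensor \<Rightarrow> ('i \<times> 'j) ell2 bop" where
  "rep_tensor_product \<pi>\<^sub>1 \<pi>\<^sub>2 = tensor_lift (\<lambda>S T. op_tensor (\<pi>\<^sub>1 S) (\<pi>\<^sub>2 T))"

lemma rep_tensor_product:
  assumes "is_representation \<pi>\<^sub>1" "is_representation \<pi>\<^sub>2"
  shows "clinear (rep_tensor_product \<pi>\<^sub>1 \<pi>\<^sub>2)"
    and "rep_tensor_product \<pi>\<^sub>1 \<pi>\<^sub>2 (S \<otimes> T) = op_tensor (\<pi>\<^sub>1 S) (\<pi>\<^sub>2 T)"
proof -
  have "cbilinear (\<lambda>S T. op_tensor (\<pi>\<^sub>1 S) (\<pi>\<^sub>2 T))"
    using assms by (simp add: is_representation_def cbilinear_def clinear_def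
        cbilinear_op_tensor[unfolded cbilinear_def clinear_def])
  from tensor_lift[OF this] show "clinear (rep_tensor_product \<pi>\<^sub>1 \<pi>\<^sub>2)"
    "rep_tensor_product \<pi>\<^sub>1 \<pi>\<^sub>2 (S \<otimes> T) = op_tensor (\<pi>\<^sub>1 S) (\<pi>\<^sub>2 T)"
    unfolding rep_tensor_product_def by blast+
qed

text \<open>
  The supremum ranges over representations on \<open>'a bop ell2\<close> and \<open>'b bop ell2\<close>. This loses nothing
  compared with representations on arbitrary Hilbert spaces: for representations \<open>\<pi>\<^sub>1\<close> on \<open>K\<^sub>1\<close> and \<open>\<pi>\<^sub>2\<close>
  on \<open>K\<^sub>2\<close>, every vector of the Hilbert space tensor product of \<open>K\<^sub>1\<close> and \<open>K\<^sub>2\<close> lies in that of two closed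
  invariant subspaces, each generated by countably many vectors. Unless the acting algebra is zero, their Hilbert dimensions
  are at most the cardinality of \<open>'a bop\<close> and \<open>'b bop\<close>, respectively, so that they embed in
  \<open>'a bop ell2\<close> and \<open>'b bop ell2\<close>; extend the restricted representations by zero on the orthogonal
  complements. The supremum is finite because representations are contractive.
\<close>

definition min_norm :: "('a::complex_hilbert bop, 'b::complex_hilbert bop) tensor \<Rightarrow> real" where
  "min_norm u =
    (SUP (\<pi>\<^sub>1, \<pi>\<^sub>2) \<in> {\<pi>\<^sub>1 :: 'a bop \<Rightarrow> 'a bop ell2 bop. is_representation \<pi>\<^sub>1}
        \<times> {\<pi>\<^sub>2 :: 'b bop \<Rightarrow> 'b bop ell2 bop. is_representation \<pi>\<^sub>2}.
      norm (rep_tensor_product \<pi>\<^sub>1 \<pi>\<^sub>2 u))"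

text \<open>
  \<open>\<iota>\<close> exhibits the Banach space \<open>'z\<close> as the completion of the algebraic tensor product of \<open>B(H)\<close> and
  \<open>B(K)\<close> in the minimal norm; such a completion is unique up to isometric isomorphism.
\<close>

definition is_min_tensor_product ::
    "(('a::complex_hilbert bop, 'b::complex_hilbert bop) tensor \<Rightarrow> 'z::complex_banach) \<Rightarrow> bool" where
  "is_min_tensor_product \<iota> \<longleftrightarrow>
    clinear \<iota> \<and> (\<forall>u. norm (\<iota> u) = min_norm u) \<and> closure (range \<iota>) = UNIV"

end

theory Submission
  imports Defs
begin

text \<open>
  Write \<open>T\<^sub>i x = \<langle>x, b\<^sub>i\<rangle> a\<^sub>i\<close>. If \<open>\<kappa>\<^sub>i = \<langle>S\<^sub>i b\<^sub>i, a\<^sub>i\<rangle>\<close> vanishes, testing \<open>T\<^sub>i + \<alpha> S\<^sub>i\<close> on \<open>b\<^sub>i\<close> and \<open>a\<^sub>i\<close>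
  gives \<open>T\<^sub>i \<bottom>\<^sub>B\<^sub>J S\<^sub>i\<close>. Suppose that neither does. The algebraic relations saying that \<open>T\<^sub>i\<close> is
  \<open>\<parallel>T\<^sub>i\<parallel>\<close> times a partial isometry, together with \<open>T\<^sub>i\<^sup>* S\<^sub>i T\<^sub>i\<^sup>* T\<^sub>i = \<kappa>\<^sub>i T\<^sub>i\<^sup>* T\<^sub>i\<close>, pass to every pair of
  representations and to the tensor product, with constant \<open>\<kappa>\<^sub>1 \<kappa>\<^sub>2\<close>. They yield a single \<open>\<alpha>\<close>, a small
  negative multiple of the conjugate of \<open>\<kappa>\<^sub>1 \<kappa>\<^sub>2\<close>, for which the norm of \<open>T\<^sub>1 \<otimes> T\<^sub>2 + \<alpha> (S\<^sub>1 \<otimes> S\<^sub>2)\<close> is below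
  \<open>\<parallel>T\<^sub>1\<parallel> \<parallel>T\<^sub>2\<parallel>\<close> uniformly in the representations. A faithful representation shows that \<open>T\<^sub>1 \<otimes> T\<^sub>2\<close> attains
  this value.
\<close>

section \<open>Complex inner products\<close>

lemma cinner_add_right: "cinner x (y + z) = cinner x y + cinner x (z :: 'a::complex_inner)"
  by (metis cinner_add_left cinner_commute complex_cnj_add)

lemma cinner_scaleC_right: "cinner x (c *\<^sub>C y) = cnj c * cinner x (y :: 'a::complex_inner)"
  by (metis cinner_scaleC_left cinner_commute complex_cnj_mult)

lemma cinner_zero_left [simp]: "cinner 0 (x :: 'a::complex_inner) = 0"
  using cinner_add_left[of 0 0 x] by simp

lemma cinner_zero_right [simp]: "cinner (x :: 'a::complex_inner) 0 = 0"
  using cinner_add_right[of x 0 0] by simp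

lemma cinner_diff_left: "cinner (x - y) z = cinner x z - cinner y (z :: 'a::complex_inner)"
  using cinner_add_left[of "x - y" y z] by simp

lemma cinner_diff_right: "cinner x (y - z) = cinner x y - cinner x (z :: 'a::complex_inner)"
  using cinner_add_right[of x "y - z" z] by simp

lemma cinner_eq_zeroI: "(x :: 'a::complex_inner) = 0" if "cinner x x = 0"
  using that by (simp add: cinner_norm)

lemma cinner_eqI: "(\<And>z. cinner z x = cinner z y) \<Longrightarrow> x = (y :: 'a::complex_inner)"
  using cinner_eq_zeroI[of "x - y"] by (simp add: cinner_diff_right)

lemma norm_add_square:
  "(norm (x + y))\<^sup>2 = (norm x)\<^sup>2 + (norm y)\<^sup>2 + 2 * Re (cinner x (y :: 'a::complex_inner))"
proof -
  have "complex_of_real ((norm (x + y))\<^sup>2) = cinner x x + cinner y y + (cinner x y + cnj (cinner x y))"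
    unfolding cinner_norm[symmetric] cinner_commute[of y x, symmetric]
    by (simp add: cinner_add_left cinner_add_right)
  then have "Re (complex_of_real ((norm (x + y))\<^sup>2))
      = Re (cinner x x + cinner y y + (cinner x y + cnj (cinner x y)))"
    by (rule arg_cong)
  then show ?thesis by (simp add: cinner_norm)
qed

text \<open>The vector added to \<open>x\<close> is minus its projection onto the line of
  \<open>y\<close>. The identity underlies Cauchy-Schwarz, the orthogonality of the Riesz minimiser
  and the induction for Bessel's inequality.\<close>

lemma norm_minus_projection_square:
  fixes x y :: "'a::complex_inner"
  assumes "y \<noteq> 0"
  shows "(norm (x + (- cinner x y / (norm y)\<^sup>2) *\<^sub>C y))\<^sup>2
    = (norm x)\<^sup>2 - (cmod (cinner x y))\<^sup>2 / (norm y)\<^sup>2"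
proof -
  let ?c = "- cinner x y / (norm y)\<^sup>2"
  have n: "(norm (?c *\<^sub>C y))\<^sup>2 = (cmod (cinner x y))\<^sup>2 / (norm y)\<^sup>2"
    using assms by (simp add: norm_scaleC norm_divide norm_power power_mult_distrib power_divide)
      (simp add: power2_eq_square power4_eq_xxxx field_simps)
  have "cinner x (?c *\<^sub>C y) = - complex_of_real ((cmod (cinner x y))\<^sup>2 / (norm y)\<^sup>2)"
    by (simp add: cinner_scaleC_right complex_norm_square mult.commute del: of_real_power)
  then have "Re (cinner x (?c *\<^sub>C y)) = - ((cmod (cinner x y))\<^sup>2 / (norm y)\<^sup>2)"
    by (simp only: uminus_complex.sel Re_complex_of_real)
  with n show ?thesis unfolding norm_add_square by linarith
qed

lemma norm_cinner_le: "cmod (cinner x y) \<le> norm x * norm (y :: 'a::complex_inner)"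
proof (cases "y = 0")
  case False
  have "0 \<le> (norm x)\<^sup>2 - (cmod (cinner x y))\<^sup>2 / (norm y)\<^sup>2"
    unfolding norm_minus_projection_square[OF False, symmetric] by simp
  then have "(cmod (cinner x y))\<^sup>2 \<le> (norm x * norm y)\<^sup>2"
    using False by (simp add: field_simps power_mult_distrib)
  then show ?thesis by (rule power2_le_imp_le) simp
qed simp

section \<open>Riesz representation and adjoints\<close>

text \<open>The hyperplane \<open>f x = 1\<close> has a point \<open>z\<close> of minimal norm. It
  is orthogonal to the kernel of \<open>f\<close>, so \<open>z\<close> divided by its squared norm
  represents \<open>f\<close>.\<close>

lemma riesz_representation:
  fixes f :: "'a::complex_hilbert \<Rightarrow> complex"
  assumes f: "clinear f" and C: "\<And>x. cmod (f x) \<le> C * norm x"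
  shows "\<exists>b. \<forall>x. f x = cinner x b"
proof (cases "\<forall>x. f x = 0")
  case True
  then show ?thesis by (intro exI[of _ 0]) simp
next
  case False
  have fadd: "f (x + y) = f x + f y" and fsc: "f (c *\<^sub>C x) = c * f x" for x y c
    using f by (simp_all add: clinear_def scaleC_complex_def)
  have fdiff: "f (x - y) = f x - f y" for x y
    using fadd[of "x - y" y] by simp
  define S where "S = {x. f x = 1}"
  define d where "d = (INF x\<in>S. (norm x)\<^sup>2)"
  have bdd: "bdd_below ((\<lambda>x. (norm x)\<^sup>2) ` S)"
    by (rule bdd_belowI[of _ 0]) auto
  have d_le: "d \<le> (norm x)\<^sup>2" if "f x = 1" for x
    unfolding d_def using that by (intro cINF_lower[OF bdd]) (simp add: S_def)
  obtain x0 where "f x0 \<noteq> 0" using False by blast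
  then have "inverse (f x0) *\<^sub>C x0 \<in> S" by (simp add: S_def fsc)
  then have "S \<noteq> {}" by blast
  have "\<exists>x. f x = 1 \<and> (norm x)\<^sup>2 < d + inverse (real (Suc n))" for n
    using cINF_less_iff[OF \<open>S \<noteq> {}\<close> bdd, of "d + inverse (real (Suc n))"]
    by (auto simp: d_def S_def)
  then obtain X where X1: "\<And>n. f (X n) = 1"
    and X2: "\<And>n. (norm (X n))\<^sup>2 < d + inverse (real (Suc n))" by metis
  \<comment> \<open>Parallelogram law: the midpoint of \<open>X m\<close> and \<open>X n\<close>
    stays on the hyperplane, so its squared norm is at least \<open>d\<close>.\<close>
  have dist_X: "(norm (X m - X n))\<^sup>2 \<le> 4 * inverse (real (Suc N))" if "N \<le> m" "N \<le> n" for m n N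
  proof -
    have "(norm (X m - X n))\<^sup>2 + (norm (X m + X n))\<^sup>2 = 2 * (norm (X m))\<^sup>2 + 2 * (norm (X n))\<^sup>2"
      using norm_add_square[of "X m" "- X n"] norm_add_square[of "X m" "X n"]
        cinner_diff_right[of "X m" 0 "X n"] by simp
    moreover have "d \<le> (norm ((1/2) *\<^sub>C (X m + X n)))\<^sup>2"
      by (rule d_le) (simp add: fsc fadd X1)
    then have "4 * d \<le> (norm (X m + X n))\<^sup>2"
      by (simp add: norm_scaleC norm_divide power_divide)
    moreover have "inverse (real (Suc m)) \<le> inverse (real (Suc N))"
      "inverse (real (Suc n)) \<le> inverse (real (Suc N))" using that by simp_all
    ultimately show ?thesis using X2[of m] X2[of n] by linarith
  qed
  have "Cauchy X"
  proof (rule metric_CauchyI)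
    fix e :: real assume e: "0 < e"
    obtain N where N: "inverse (real (Suc N)) < e\<^sup>2 / 4"
      using reals_Archimedean[of "e\<^sup>2 / 4"] e by auto
    have "dist (X m) (X n) < e" if "N \<le> m" "N \<le> n" for m n
      using dist_X[OF that] N e unfolding dist_norm
      by (intro power2_less_imp_less[of _ e]) auto
    then show "\<exists>M. \<forall>m\<ge>M. \<forall>n\<ge>M. dist (X m) (X n) < e" by blast
  qed
  then obtain z where z: "X \<longlonglongrightarrow> z" using Cauchy_convergent convergent_def by blast
  have "bounded_linear f"
    by (rule bounded_linear_intro[where K = C])
       (use C in \<open>auto simp: fadd fsc scaleR_scaleC scaleR_conv_of_real mult.commute\<close>)
  then have "(\<lambda>n. f (X n)) \<longlonglongrightarrow> f z" using z by (rule bounded_linear.tendsto)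
  then have fz: "f z = 1" by (simp add: X1 LIMSEQ_const_iff)
  have "(\<lambda>n. (norm (X n))\<^sup>2) \<longlonglongrightarrow> (norm z)\<^sup>2" by (intro tendsto_intros z)
  moreover have "(\<lambda>n. d + inverse (real (Suc n))) \<longlonglongrightarrow> d"
    by (rule LIMSEQ_inverse_real_of_nat_add)
  ultimately have nz: "(norm z)\<^sup>2 \<le> d"
    by (rule LIMSEQ_le) (use X2 in \<open>auto intro: less_imp_le\<close>)
  \<comment> \<open>Moving \<open>z\<close> along the kernel stays on the hyperplane, so removing
    its projection onto \<open>k\<close> cannot shorten it.\<close>
  have orth: "cinner z k = 0" if k: "f k = 0" for k
  proof (cases "k = 0")
    case False
    have "(norm z)\<^sup>2 \<le> (norm (z + (- cinner z k / (norm k)\<^sup>2) *\<^sub>C k))\<^sup>2"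
      by (rule order_trans[OF nz d_le]) (simp add: fadd fsc fz k)
    then have "(cmod (cinner z k))\<^sup>2 / (norm k)\<^sup>2 \<le> 0"
      unfolding norm_minus_projection_square[OF False] by simp
    then show ?thesis using False by (simp add: divide_le_0_iff)
  qed simp
  have "z \<noteq> 0" using fz clinear_zero[OF f] by auto
  have "f x = cinner x ((1 / (norm z)\<^sup>2) *\<^sub>C z)" for x
  proof -
    have "cinner z (x - f x *\<^sub>C z) = 0" by (rule orth) (simp add: fdiff fsc fz)
    then have "cinner (x - f x *\<^sub>C z) z = 0" by (metis cinner_commute complex_cnj_zero)
    then show ?thesis using \<open>z \<noteq> 0\<close>
      by (simp add: cinner_diff_left cinner_scaleC_left cinner_scaleC_right cinner_norm)
  qed
  then show ?thesis by blast
qed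

text \<open>Riesz, applied for each \<open>y\<close> to the functional <f x, y> of \<open>x\<close>,
  yields \<open>g y\<close>. Domain and codomain may differ, so that the coordinate map into
  \<open>ell2\<close> has an adjoint too.\<close>

lemma adjoint_exists:
  fixes f :: "'a::complex_hilbert \<Rightarrow> 'b::complex_inner"
  assumes f: "clinear f" and C: "\<And>x. norm (f x) \<le> C * norm x" "0 \<le> C"
  shows "\<exists>g. clinear g \<and> (\<forall>x y. cinner (f x) y = cinner x (g y)) \<and> (\<forall>y. norm (g y) \<le> C * norm y)"
proof -
  have "\<exists>b. \<forall>x. cinner (f x) y = cinner x b" for y
  proof (rule riesz_representation)
    show "clinear (\<lambda>x. cinner (f x) y)"
      using f by (simp add: clinear_def cinner_add_left cinner_scaleC_left scaleC_complex_def)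
    show "cmod (cinner (f x) y) \<le> (C * norm y) * norm x" for x
      using norm_cinner_le[of "f x" y] mult_right_mono[OF C(1)[of x], of "norm y"]
      by (simp add: mult_ac)
  qed
  then obtain g where g: "\<And>x y. cinner (f x) y = cinner x (g y)" by metis
  have "g (x + y) = g x + g y" "g (c *\<^sub>C x) = c *\<^sub>C g x" for x y c
    by (rule cinner_eqI, simp add: g[symmetric] cinner_add_right cinner_scaleC_right)+
  then have "clinear g" by (simp add: clinear_def)
  moreover have "norm (g y) \<le> C * norm y" for y
  proof (cases "g y = 0")
    case False
    have "norm (g y) * norm (g y) = cmod (cinner (f (g y)) y)"
      unfolding g by (simp add: cinner_norm norm_power flip: power2_eq_square)
    also have "\<dots> \<le> norm (f (g y)) * norm y" by (rule norm_cinner_le)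
    also have "\<dots> \<le> (C * norm (g y)) * norm y" by (rule mult_right_mono[OF C(1)]) simp
    finally show ?thesis using False by (simp add: mult_ac)
  qed (simp add: C)
  ultimately show ?thesis using g by blast
qed

lemma is_adjointD: "is_adjoint A T \<Longrightarrow> cinner (op_apply T x) y = cinner x (op_apply A y)"
  by (simp add: is_adjoint_def)

lemma is_adjoint_exists: "\<exists>A. is_adjoint A (T :: 'a::complex_hilbert bop)"
proof -
  have "clinear (op_apply T)" by (simp add: clinear_def op_apply_add op_apply_scaleC)
  from adjoint_exists[OF this norm_op_apply] show ?thesis
    unfolding is_adjoint_def by (metis bop_exists norm_ge_zero)
qed

lemma norm_bop_le: "norm T \<le> C" if "\<And>x. norm (op_apply T x) \<le> C * norm x" "0 \<le> C"
  for T :: "'a::complex_normed_vector bop"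
  using that by transfer (simp add: norm_blinfun_bound)


section \<open>Rank one operators\<close>

text \<open>The ket-bra |a><b|, of rank one when both vectors are nonzero.\<close>

definition outer :: "'a::complex_inner \<Rightarrow> 'a \<Rightarrow> 'a bop" where
  "outer a b = (THE T. \<forall>x. op_apply T x = cinner x b *\<^sub>C a)"

lemma op_apply_outer [simp]: "op_apply (outer a b) x = cinner x b *\<^sub>C a"
proof -
  have "norm (cinner x b *\<^sub>C a) \<le> (norm b * norm a) * norm x" for x
    using mult_right_mono[OF norm_cinner_le[of x b], of "norm a"] by (simp add: norm_scaleC mult_ac)
  moreover have "clinear (\<lambda>x. cinner x b *\<^sub>C a)"
    by (simp add: clinear_def cinner_add_left cinner_scaleC_left scaleC_add_left scaleC_scaleC)
  ultimately obtain T where T: "op_apply T = (\<lambda>x. cinner x b *\<^sub>C a)"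
    using bop_exists by blast
  have "\<exists>!T. \<forall>x. op_apply T x = cinner x b *\<^sub>C a"
    by (rule ex1I[of _ T]) (auto simp: T intro: op_eqI)
  from theI'[OF this] show ?thesis unfolding outer_def by blast
qed

lemma is_adjoint_outer: "is_adjoint (outer b a) (outer a b)"
  unfolding is_adjoint_def
  by (simp add: cinner_scaleC_left cinner_scaleC_right) (metis cinner_commute mult.commute)

lemma outer_times_outer: "outer a b * outer c d = cinner c b *\<^sub>C outer a d"
  by (rule op_eqI) (simp add: op_apply_times op_apply_scaleC_left cinner_scaleC_left scaleC_scaleC mult.commute)

text \<open>\<open>T x\<close> is a multiple of \<open>a\<close>, and pairing with \<open>a\<close>
  finds the coefficient: <x, A a> / |a|^2 with \<open>A\<close> the adjoint of
  \<open>T\<close>.\<close>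

lemma rank_one_outer:
  fixes T :: "'a::complex_hilbert bop"
  assumes "rank_one T"
  obtains a b where "a \<noteq> 0" "b \<noteq> 0" "T = outer a b"
proof -
  obtain a where a: "a \<noteq> 0" "range (op_apply T) = range (\<lambda>c. c *\<^sub>C a)"
    using assms by (auto simp: rank_one_def)
  obtain A where A: "is_adjoint A T" using is_adjoint_exists by blast
  let ?b = "(1 / (norm a)\<^sup>2) *\<^sub>C op_apply A a"
  have T: "T = outer a ?b"
  proof (rule op_eqI)
    fix x
    obtain c where c: "op_apply T x = c *\<^sub>C a" using a(2) by (metis rangeE rangeI)
    have "cinner x (op_apply A a) = c * (norm a)\<^sup>2"
      using is_adjointD[OF A, of x a] by (simp add: c cinner_scaleC_left cinner_norm)
    then show "op_apply T x = op_apply (outer a ?b) x"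
      using a(1) by (simp add: c cinner_scaleC_right)
  qed
  have "?b \<noteq> 0"
  proof
    assume "?b = 0"
    moreover have "1 *\<^sub>C a \<in> range (op_apply T)" unfolding a(2) by blast
    ultimately show False using a(1) by (subst (asm) T) (auto simp: scaleC_one)
  qed
  with a(1) T show thesis by (metis that)
qed

text \<open>By hypothesis <?R b, a> is |a|^2 |b|^2 whatever \<alpha> is. Cauchy-Schwarz then gives
  |a| |b| as a lower bound for the norm of \<open>?R\<close>.\<close>

lemma BJ_orthogonal_outer:
  assumes "cinner (op_apply S b) a = 0" "a \<noteq> 0" "b \<noteq> 0"
  shows "outer a b \<bottom>\<^sub>B\<^sub>J S"
  unfolding BJ_orthogonal_def
proof
  fix \<alpha>
  let ?R = "outer a b + \<alpha> *\<^sub>C S"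
  have le: "norm (outer a b) \<le> norm a * norm b"
    using mult_right_mono[OF norm_cinner_le[of _ b], of "norm a"]
    by (intro norm_bop_le) (simp_all add: norm_scaleC mult_ac)
  have "cinner (op_apply ?R b) a = complex_of_real ((norm a * norm b)\<^sup>2)"
    using assms by (simp add: op_apply_add_left op_apply_scaleC_left cinner_add_left
        cinner_scaleC_left cinner_norm power_mult_distrib)
  then have "(norm a * norm b)\<^sup>2 \<le> norm (op_apply ?R b) * norm a"
    using norm_cinner_le[of "op_apply ?R b" a] by (simp add: norm_mult norm_power del: of_real_power of_real_mult)
  also have "\<dots> \<le> norm ?R * (norm a * norm b)"
    using mult_right_mono[OF norm_op_apply[of ?R b], of "norm a"] by (simp add: mult_ac)
  finally have "(norm a * norm b) * (norm a * norm b) \<le> norm ?R * (norm a * norm b)"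
    by (simp only: power2_eq_square)
  then have "norm a * norm b \<le> norm ?R"
    by (rule mult_right_le_imp_le) (use assms in simp)
  with le show "norm (outer a b) \<le> norm ?R" by linarith
qed

section \<open>Scalar multiples of partial isometries\<close>

text \<open>The second condition says that \<open>R\<close> is \<open>sqrt \<tau>\<close> times a partial isometry. It is phrased
  algebraically so that it passes to representations and tensor products.\<close>

definition scaled_partial_isometry :: "'a::complex_inner bop \<Rightarrow> 'a bop \<Rightarrow> real \<Rightarrow> bool" where
  "scaled_partial_isometry A R \<tau> \<longleftrightarrow>
    is_adjoint A R \<and> (A * R) * (A * R) = complex_of_real \<tau> *\<^sub>C (A * R)"

lemma is_adjointD2: "is_adjoint A T \<Longrightarrow> cinner (op_apply A x) y = cinner x (op_apply T y)"
  by (metis cinner_commute is_adjointD)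

context
  fixes A R :: "'a::complex_inner bop" and \<tau> :: real
  assumes R: "scaled_partial_isometry A R \<tau>" and \<tau>: "0 \<le> \<tau>"
begin

private lemma adj: "is_adjoint A R"
  using R by (simp add: scaled_partial_isometry_def)

private lemma idem: "op_apply A (op_apply R (op_apply A (op_apply R x))) = complex_of_real \<tau> *\<^sub>C op_apply A (op_apply R x)"
proof -
  have "op_apply ((A * R) * (A * R)) x = op_apply (complex_of_real \<tau> *\<^sub>C (A * R)) x"
    using R by (simp add: scaled_partial_isometry_def)
  then show ?thesis by (simp add: op_apply_times op_apply_scaleC_left)
qed

private lemma norm_R_square: "complex_of_real ((norm (op_apply R x))\<^sup>2) = cinner (op_apply A (op_apply R x)) x"
  by (simp add: is_adjointD2[OF adj] cinner_norm)

text \<open>|A R x|^2 = <A R A R x, x> = \<tau> <A R x, x> = \<tau> |R x|^2.\<close>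

private lemma norm_AR: "norm (op_apply A (op_apply R x)) = sqrt \<tau> * norm (op_apply R x)"
proof -
  let ?y = "op_apply A (op_apply R x)"
  have "cinner ?y ?y = complex_of_real \<tau> * complex_of_real ((norm (op_apply R x))\<^sup>2)"
    unfolding norm_R_square
    by (simp only: is_adjointD2[OF adj, of "op_apply R x"] is_adjointD[OF adj, of x] idem cinner_scaleC_right)
       (simp add: is_adjointD2[OF adj] is_adjointD[OF adj])
  then have "(norm ?y)\<^sup>2 = \<tau> * (norm (op_apply R x))\<^sup>2"
    by (simp only: cinner_norm flip: of_real_mult) (simp only: of_real_eq_iff)
  then show ?thesis using \<tau>
    by (metis norm_ge_zero real_sqrt_abs abs_of_nonneg real_sqrt_mult)
qed

text \<open>|R x|^2 = <A R x, x> \<le> |A R x| |x|; after \<open>norm_AR\<close> one factor |R x|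
  cancels.\<close>

lemma scaled_partial_isometry_norm_le: "norm R \<le> sqrt \<tau>"
proof (rule norm_bop_le)
  fix x
  have "(norm (op_apply R x))\<^sup>2 \<le> norm (op_apply A (op_apply R x)) * norm x"
    using norm_cinner_le[of "op_apply A (op_apply R x)" x] unfolding norm_R_square[symmetric]
    by (simp add: norm_power)
  then have "norm (op_apply R x) * norm (op_apply R x) \<le> (sqrt \<tau> * norm x) * norm (op_apply R x)"
    by (simp add: norm_AR power2_eq_square mult_ac)
  then show "norm (op_apply R x) \<le> sqrt \<tau> * norm x"
    using \<tau> by (cases "norm (op_apply R x) = 0") (auto simp: mult_le_cancel_right)
qed (use \<tau> in simp)

text \<open>\<open>A R x\<close> lies in the initial space, where \<open>R\<close> multiplies norms
  by exactly \<open>sqrt \<tau>\<close>.\<close>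

lemma scaled_partial_isometry_norm_ge:
  assumes "op_apply R x \<noteq> 0"
  shows "sqrt \<tau> \<le> norm R"
proof -
  let ?y = "op_apply A (op_apply R x)"
  have "?y \<noteq> 0" using norm_R_square[of x] assms by auto
  have "complex_of_real ((norm (op_apply R ?y))\<^sup>2) = complex_of_real (\<tau> * (norm ?y)\<^sup>2)"
    unfolding norm_R_square idem by (simp add: cinner_scaleC_left cinner_norm)
  then have "(norm (op_apply R ?y))\<^sup>2 = (sqrt \<tau> * norm ?y)\<^sup>2"
    using \<tau> by (simp only: of_real_eq_iff power_mult_distrib real_sqrt_pow2)
  then have "sqrt \<tau> * norm ?y = norm (op_apply R ?y)" using \<tau> by (simp add: power2_eq_iff_nonneg)
  also have "\<dots> \<le> norm R * norm ?y" by (rule norm_op_apply)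
  finally show ?thesis using \<open>?y \<noteq> 0\<close> by simp
qed

text \<open>Split \<open>x\<close> into its component \<open>y\<close> in the initial space of \<open>R\<close> and \<open>z = x - y\<close>, on which \<open>R\<close>
  vanishes. The hypothesis on \<open>Q\<close> means \<open>\<langle>Q y, R y\<rangle> = \<kappa> \<parallel>y\<parallel>\<^sup>2\<close>.\<close>

lemma norm_perturbed_square_le:
  assumes "0 < \<tau>" and Q: "A * (Q * (A * R)) = \<kappa> *\<^sub>C (A * R)" and q: "norm Q \<le> q"
  shows "\<exists>p r. (norm x)\<^sup>2 = p\<^sup>2 + r\<^sup>2 \<and>
    (norm (op_apply (R + \<alpha> *\<^sub>C Q) x))\<^sup>2 \<le> (\<tau> + 2 * Re (\<alpha> * \<kappa>)) * p\<^sup>2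
      + 2 * (cmod \<alpha> * q * sqrt \<tau> * p * r) + (cmod \<alpha> * q)\<^sup>2 * (p\<^sup>2 + r\<^sup>2)"
proof -
  \<comment> \<open>\<open>A R\<close> divided by \<tau> is idempotent and self-adjoint: the
    projection onto the initial space.\<close>
  define y where "y = complex_of_real (1 / \<tau>) *\<^sub>C op_apply A (op_apply R x)"
  define z where "z = x - y"
  have ARy: "op_apply A (op_apply R y) = op_apply A (op_apply R x)"
    using \<open>0 < \<tau>\<close> by (simp add: y_def op_apply_scaleC idem scaleC_scaleC scaleC_one)
  have "op_apply A (op_apply R z) = 0"
    using op_apply_add[of R y z] op_apply_add[of A "op_apply R y" "op_apply R z"]
    by (simp add: ARy z_def)
  then have Rz: "op_apply R z = 0"
    using norm_R_square[of z] by simp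
  then have Rx: "op_apply R x = op_apply R y"
    using op_apply_add[of R y z] by (simp add: z_def)
  have "cinner y z = 0"
    by (simp add: y_def cinner_scaleC_left is_adjointD2[OF adj] Rz)
  then have x: "(norm x)\<^sup>2 = (norm y)\<^sup>2 + (norm z)\<^sup>2"
    using norm_add_square[of y z] by (simp add: z_def)
  have "complex_of_real ((norm (op_apply R y))\<^sup>2) = complex_of_real (\<tau> * (norm y)\<^sup>2)"
    using \<open>0 < \<tau>\<close> by (simp only: norm_R_square ARy)
      (simp add: y_def cinner_scaleC_left cinner_scaleC_right cinner_norm power_mult_distrib
        norm_scaleC norm_divide power_divide, simp add: power2_eq_square)
  then have Ry: "(norm (op_apply R y))\<^sup>2 = \<tau> * (norm y)\<^sup>2"
    by (simp only: of_real_eq_iff)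
  then have Ry': "norm (op_apply R y) = sqrt \<tau> * norm y"
    by (metis norm_ge_zero real_sqrt_abs abs_of_nonneg real_sqrt_mult)
  have "op_apply A (op_apply Q (op_apply A (op_apply R w))) = \<kappa> *\<^sub>C op_apply A (op_apply R w)" for w
    using arg_cong[OF Q, of "\<lambda>T. op_apply T w"] by (simp add: op_apply_times op_apply_scaleC_left)
  then have "op_apply A (op_apply Q y) = \<kappa> *\<^sub>C y"
    by (simp add: y_def op_apply_scaleC scaleC_scaleC mult.commute)
  then have "cinner (op_apply Q y) (op_apply R y) = \<kappa> * (norm y)\<^sup>2"
    using is_adjointD2[OF adj, of "op_apply Q y" y] by (simp add: cinner_scaleC_left cinner_norm)
  moreover have "op_apply Q x = op_apply Q y + op_apply Q z"
    using op_apply_add[of Q y z] by (simp add: z_def)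
  \<comment> \<open>The part of \<open>Q x\<close> coming from \<open>y\<close> gives the \<kappa>
    term exactly; the part from \<open>z\<close> is only estimated, by Cauchy-Schwarz.\<close>
  ultimately have "cinner (\<alpha> *\<^sub>C op_apply Q x) (op_apply R x)
      = (\<alpha> * \<kappa>) * (norm y)\<^sup>2 + \<alpha> * cinner (op_apply Q z) (op_apply R y)"
    by (simp add: Rx cinner_scaleC_left cinner_add_left algebra_simps)
  then have "Re (cinner (\<alpha> *\<^sub>C op_apply Q x) (op_apply R x))
      = Re (\<alpha> * \<kappa>) * (norm y)\<^sup>2 + Re (\<alpha> * cinner (op_apply Q z) (op_apply R y))"
    by (simp only: plus_complex.sel Re_complex_of_real flip: of_real_power)
       (simp add: mult.commute)
  also have "Re (\<alpha> * cinner (op_apply Q z) (op_apply R y))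
      \<le> cmod (\<alpha> * cinner (op_apply Q z) (op_apply R y))"
    by (rule complex_Re_le_cmod)
  also have "\<dots> \<le> cmod \<alpha> * (norm (op_apply Q z) * norm (op_apply R y))"
    by (simp add: norm_mult mult_left_mono norm_cinner_le)
  also have "\<dots> \<le> cmod \<alpha> * ((q * norm z) * (sqrt \<tau> * norm y))"
    using \<open>0 < \<tau>\<close> norm_op_apply[of Q z] mult_right_mono[OF q, of "norm z"]
    unfolding Ry' by (intro mult_left_mono mult_right_mono) auto
  finally have cross: "Re (cinner (op_apply R x) (\<alpha> *\<^sub>C op_apply Q x))
      \<le> Re (\<alpha> * \<kappa>) * (norm y)\<^sup>2 + cmod \<alpha> * q * sqrt \<tau> * norm y * norm z"
    by (subst cinner_commute) (simp add: mult_ac)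
  have "norm (\<alpha> *\<^sub>C op_apply Q x) \<le> cmod \<alpha> * q * norm x"
    using mult_left_mono[OF order_trans[OF norm_op_apply[of Q x] mult_right_mono[OF q, of "norm x"]], of "cmod \<alpha>"]
    by (simp add: norm_scaleC mult_ac)
  then have "(norm (\<alpha> *\<^sub>C op_apply Q x))\<^sup>2 \<le> (cmod \<alpha> * q * norm x)\<^sup>2"
    by (rule power_mono) simp
  then have "(norm (\<alpha> *\<^sub>C op_apply Q x))\<^sup>2 \<le> (cmod \<alpha> * q)\<^sup>2 * ((norm y)\<^sup>2 + (norm z)\<^sup>2)"
    by (simp only: power_mult_distrib[of "cmod \<alpha> * q"] x)
  moreover have "(norm (op_apply (R + \<alpha> *\<^sub>C Q) x))\<^sup>2 = \<tau> * (norm y)\<^sup>2 + (norm (\<alpha> *\<^sub>C op_apply Q x))\<^sup>2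
      + 2 * Re (cinner (op_apply R x) (\<alpha> *\<^sub>C op_apply Q x))"
    by (simp add: op_apply_add_left op_apply_scaleC_left norm_add_square Rx Ry)
  ultimately have "(norm (op_apply (R + \<alpha> *\<^sub>C Q) x))\<^sup>2 \<le> (\<tau> + 2 * Re (\<alpha> * \<kappa>)) * (norm y)\<^sup>2
      + 2 * (cmod \<alpha> * q * sqrt \<tau> * norm y * norm z) + (cmod \<alpha> * q)\<^sup>2 * ((norm y)\<^sup>2 + (norm z)\<^sup>2)"
    using cross unfolding distrib_right by linarith
  with x show ?thesis by blast
qed

end

section \<open>Uniform decrease of the norm under a small perturbation\<close>

text \<open>Of the loss \<open>2 t k^2\<close> on \<open>p^2\<close>, half absorbs the cross term
  and a quarter the quadratic term, leaving \<open>\<tau> - t k^2 / 2\<close>. On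
  \<open>r^2\<close>, where nothing is lost, the coefficient is kept small.\<close>

lemma perturbation_constants:
  fixes \<tau> k q :: real
  assumes "0 < \<tau>" "0 < k" "0 \<le> q"
  shows "\<exists>t>0. \<exists>m\<ge>0. m < \<tau> \<and> (\<forall>p r. (\<tau> - 2 * (t * k\<^sup>2)) * p\<^sup>2
      + 2 * (t * k * q * sqrt \<tau> * p * r) + (t * k * q)\<^sup>2 * (p\<^sup>2 + r\<^sup>2) \<le> m * (p\<^sup>2 + r\<^sup>2))"
proof -
  \<comment> \<open>The first bound tames the quadratic term through
    \<open>t q^2 \<le> 1 / 2\<close>; the second keeps the coefficient of \<open>r^2\<close> at most
    \<open>\<tau> / 2\<close>. The \<open>+ 1\<close> covers \<open>q = 0\<close>.\<close>
  define t where "t = min (1 / (2 * (q\<^sup>2 + 1))) (\<tau> / (2 * (q\<^sup>2 * \<tau> + k\<^sup>2)))"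
  have den: "0 < q\<^sup>2 * \<tau> + k\<^sup>2" "0 < q\<^sup>2 + 1" using assms by (simp_all add: add_nonneg_pos)
  then have "0 < t" using assms by (simp add: t_def)
  have "t \<le> 1 / (2 * (q\<^sup>2 + 1))" by (simp add: t_def)
  then have "t * (2 * (q\<^sup>2 + 1)) \<le> 1" using den by (simp add: field_simps)
  then have tq: "t * q\<^sup>2 \<le> 1 / 2" using \<open>0 < t\<close> by (simp add: algebra_simps)
  have "t \<le> \<tau> / (2 * (q\<^sup>2 * \<tau> + k\<^sup>2))" by (simp add: t_def)
  then have tt: "t * (q\<^sup>2 * \<tau> + k\<^sup>2) \<le> \<tau> / 2" using den by (simp add: field_simps)
  have "(t * k\<^sup>2) * (t * q\<^sup>2) \<le> (t * k\<^sup>2) * (1 / 2)"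
    using \<open>0 < t\<close> by (intro mult_left_mono tq) simp
  then have sq: "(t * k * q)\<^sup>2 \<le> t * k\<^sup>2 / 2" by (simp add: power2_eq_square mult_ac)
  \<comment> \<open>The entries serve \<open>p^2\<close> and \<open>r^2\<close> respectively; the
    second also keeps \<open>m\<close> nonnegative, so that \<open>sqrt m\<close> can be a norm
    bound.\<close>
  define m where "m = max (\<tau> - t * k\<^sup>2 / 2) (\<tau> / 2)"
  have "(\<tau> - 2 * (t * k\<^sup>2)) * p\<^sup>2 + 2 * (t * k * q * sqrt \<tau> * p * r) + (t * k * q)\<^sup>2 * (p\<^sup>2 + r\<^sup>2)
      \<le> m * (p\<^sup>2 + r\<^sup>2)" for p r
  proof -
    \<comment> \<open>Expanding the square gives the weighted AM-GM bound for the cross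
      term.\<close>
    have "0 \<le> t * (k * p - q * sqrt \<tau> * r)\<^sup>2" using \<open>0 < t\<close> by simp
    then have "2 * (t * k * q * sqrt \<tau> * p * r) \<le> t * k\<^sup>2 * p\<^sup>2 + t * (q\<^sup>2 * \<tau>) * r\<^sup>2"
      using \<open>0 < \<tau>\<close> by (simp add: power2_diff power_mult_distrib algebra_simps)
    moreover have "(t * k * q)\<^sup>2 * (p\<^sup>2 + r\<^sup>2) \<le> t * k\<^sup>2 / 2 * (p\<^sup>2 + r\<^sup>2)"
      by (intro mult_right_mono sq) simp
    moreover have "(\<tau> - t * k\<^sup>2 / 2) * p\<^sup>2 \<le> m * p\<^sup>2" by (intro mult_right_mono) (simp_all add: m_def)
    moreover have "t * (q\<^sup>2 * \<tau> + k\<^sup>2) * r\<^sup>2 \<le> m * r\<^sup>2"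
      by (intro mult_right_mono order_trans[OF tt]) (simp_all add: m_def)
    moreover have "0 \<le> t * k\<^sup>2 * r\<^sup>2" using \<open>0 < t\<close> by simp
    ultimately show ?thesis by (simp add: algebra_simps)
  qed
  moreover have "m < \<tau>" "0 \<le> m" using assms \<open>0 < t\<close> by (auto simp: m_def)
  ultimately show ?thesis using \<open>0 < t\<close> by blast
qed

text \<open>\<alpha> and \<open>c\<close> are chosen before \<open>A\<close>, \<open>R\<close> and
  \<open>Q\<close>; this uniformity lets the bound survive the supremum over
  representations.\<close>

lemma perturbation_decreases_norm:
  fixes \<tau> q :: real and \<kappa> :: complex
  assumes "0 < \<tau>" "\<kappa> \<noteq> 0" "0 \<le> q"
  obtains \<alpha> c where "c < sqrt \<tau>"
    "\<And>A R Q :: 'a::complex_inner bop. scaled_partial_isometry A R \<tau> \<Longrightarrow>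
      A * (Q * (A * R)) = \<kappa> *\<^sub>C (A * R) \<Longrightarrow> norm Q \<le> q \<Longrightarrow> norm (R + \<alpha> *\<^sub>C Q) \<le> c"
proof -
  obtain t m where tm: "0 < t" "0 \<le> m" "m < \<tau>" and
    bound: "\<And>p r. (\<tau> - 2 * (t * (cmod \<kappa>)\<^sup>2)) * p\<^sup>2 + 2 * (t * cmod \<kappa> * q * sqrt \<tau> * p * r)
      + (t * cmod \<kappa> * q)\<^sup>2 * (p\<^sup>2 + r\<^sup>2) \<le> m * (p\<^sup>2 + r\<^sup>2)"
    using perturbation_constants[of \<tau> "cmod \<kappa>" q] assms by auto
  let ?\<alpha> = "- (complex_of_real t * cnj \<kappa>)"
  have mod: "cmod ?\<alpha> = t * cmod \<kappa>" using tm by (simp add: norm_mult)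
  have "?\<alpha> * \<kappa> = - complex_of_real (t * (cmod \<kappa>)\<^sup>2)"
    by (simp add: complex_norm_square mult_ac del: of_real_power)
  then have re: "Re (?\<alpha> * \<kappa>) = - (t * (cmod \<kappa>)\<^sup>2)"
    by (simp only: uminus_complex.sel Re_complex_of_real)
  show thesis
  proof (rule that[of "sqrt m" ?\<alpha>])
    fix A R Q :: "'a bop"
    assume R: "scaled_partial_isometry A R \<tau>" and Q: "A * (Q * (A * R)) = \<kappa> *\<^sub>C (A * R)" "norm Q \<le> q"
    show "norm (R + ?\<alpha> *\<^sub>C Q) \<le> sqrt m"
    proof (rule norm_bop_le)
      fix x
      obtain p r where x: "(norm x)\<^sup>2 = p\<^sup>2 + r\<^sup>2" and
        "(norm (op_apply (R + ?\<alpha> *\<^sub>C Q) x))\<^sup>2 \<le> (\<tau> + 2 * Re (?\<alpha> * \<kappa>)) * p\<^sup>2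
          + 2 * (cmod ?\<alpha> * q * sqrt \<tau> * p * r) + (cmod ?\<alpha> * q)\<^sup>2 * (p\<^sup>2 + r\<^sup>2)"
        using norm_perturbed_square_le[OF R _ _ Q] assms by (meson less_imp_le)
      then have "(norm (op_apply (R + ?\<alpha> *\<^sub>C Q) x))\<^sup>2 \<le> m * (p\<^sup>2 + r\<^sup>2)"
        unfolding mod re using bound[of p r] by simp
      then have "(norm (op_apply (R + ?\<alpha> *\<^sub>C Q) x))\<^sup>2 \<le> (sqrt m * norm x)\<^sup>2"
        using tm by (simp add: x power_mult_distrib)
      then show "norm (op_apply (R + ?\<alpha> *\<^sub>C Q) x) \<le> sqrt m * norm x"
        by (rule power2_le_imp_le) (use tm in simp)
    qed (use tm in simp)
  qed (use tm in simp)
qed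

section \<open>Tensor products of operators\<close>

lemma op_tensor_times: "op_tensor S T * op_tensor S' T' = op_tensor (S * S') (T * T')"
  by (rule op_tensor_unique) (simp add: op_apply_op_tensor op_apply_times)

lemma op_tensor_scaleC:
  "op_tensor (c *\<^sub>C S) T = c *\<^sub>C op_tensor S T" "op_tensor S (c *\<^sub>C T) = c *\<^sub>C op_tensor S T"
  using cbilinear_op_tensor unfolding cbilinear_def clinear_def by blast+

lemma cinner_ket: "cinner x (ell2_ket j) = ell2_nth x j"
proof (transfer, goal_cases)
  case (1 x j)
  have "infsum (\<lambda>i. x i * cnj (of_bool (j = i))) UNIV = infsum (\<lambda>i. x i * cnj (of_bool (j = i))) {j}"
    by (rule infsum_cong_neutral) auto
  then show ?case by simp
qed

text \<open>Some adjoint \<open>B\<close> of \<open>T\<close> exists, its matrix entries are those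
  of \<open>A\<close>, and a bounded operator is determined by its values on kets.\<close>

lemma is_adjoint_ell2I:
  fixes A T :: "'i ell2 bop"
  assumes "\<And>i j. ell2_nth (op_apply T (ell2_ket i)) j = cnj (ell2_nth (op_apply A (ell2_ket j)) i)"
  shows "is_adjoint A T"
proof -
  obtain B where B: "is_adjoint B T" using is_adjoint_exists by blast
  have "ell2_nth (op_apply B (ell2_ket j)) i = ell2_nth (op_apply A (ell2_ket j)) i" for i j
  proof -
    have "ell2_nth (op_apply B (ell2_ket j)) i = cinner (ell2_ket j) (op_apply T (ell2_ket i))"
      by (simp add: is_adjointD2[OF B] flip: cinner_ket)
    also have "\<dots> = cnj (ell2_nth (op_apply T (ell2_ket i)) j)"
      by (subst cinner_commute) (simp add: cinner_ket)
    finally show ?thesis by (simp add: assms)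
  qed
  then have "B = A" by (intro bop_ket_eqI ell2_eqI)
  with B show ?thesis by simp
qed

text \<open>Matrix entries of a tensor product are products of matrix entries, so conjugate symmetry
  holds factor by factor.\<close>

lemma is_adjoint_op_tensor:
  assumes "is_adjoint A S" "is_adjoint B T"
  shows "is_adjoint (op_tensor A B) (op_tensor S T)"
proof (rule is_adjoint_ell2I)
  have ket: "ell2_ket k = ell2_tensor (ell2_ket (fst k)) (ell2_ket (snd k))" for k :: "'k \<times> 'l"
    by (rule ell2_prod_eqI) (auto simp: prod_eq_iff)
  have nth: "ell2_nth (op_apply T (ell2_ket i)) j = cnj (ell2_nth (op_apply A (ell2_ket j)) i)"
    if "is_adjoint A T" for A T :: "'k ell2 bop" and i j
    unfolding cinner_ket[symmetric] is_adjointD[OF that] by (rule cinner_commute)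
  have tensor_nth: "ell2_nth (ell2_tensor x y) k = ell2_nth x (fst k) * ell2_nth y (snd k)"
    for x :: "'k ell2" and y :: "'l ell2" and k
    by (cases k) simp
  fix i j
  show "ell2_nth (op_apply (op_tensor S T) (ell2_ket i)) j
      = cnj (ell2_nth (op_apply (op_tensor A B) (ell2_ket j)) i)"
    by (simp add: ket[of i] ket[of j] op_apply_op_tensor tensor_nth nth[OF assms(1)] nth[OF assms(2)])
qed

lemma scaled_partial_isometry_op_tensor:
  assumes "scaled_partial_isometry A S \<sigma>" "scaled_partial_isometry B T \<tau>"
  shows "scaled_partial_isometry (op_tensor A B) (op_tensor S T) (\<sigma> * \<tau>)"
  using assms by (simp add: scaled_partial_isometry_def is_adjoint_op_tensor op_tensor_times
      op_tensor_scaleC scaleC_scaleC mult.commute)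

section \<open>Passage to representations, and the case of outer products\<close>

lemma scaled_partial_isometry_representation:
  assumes "is_representation \<pi>" "scaled_partial_isometry A R \<tau>"
  shows "scaled_partial_isometry (\<pi> A) (\<pi> R) \<tau>"
proof -
  have "\<pi> (S * T) = \<pi> S * \<pi> T" "\<pi> (c *\<^sub>C T) = c *\<^sub>C \<pi> T" "is_adjoint S T \<Longrightarrow> is_adjoint (\<pi> S) (\<pi> T)"
    for S T c using assms(1) by (auto simp: is_representation_def clinear_def)
  then show ?thesis using assms(2) unfolding scaled_partial_isometry_def by metis
qed

text \<open>\<open>outer b a * outer a b\<close> is |a|^2 times \<open>outer b b\<close>, and
  \<open>outer b b\<close> squares to |b|^2 times itself.\<close>

lemma scaled_partial_isometry_outer:
  "scaled_partial_isometry (outer b a) (outer a b) ((norm a * norm b)\<^sup>2)"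
  unfolding scaled_partial_isometry_def
  by (simp add: is_adjoint_outer outer_times_outer)
     (rule op_eqI, simp add: op_apply_times op_apply_scaleC_left op_apply_scaleC cinner_norm
       cinner_scaleC_left scaleC_scaleC power_mult_distrib mult_ac)

text \<open>\<open>outer b a * outer a b\<close> maps into the line of \<open>b\<close>, on which
  \<open>outer b a * S\<close> is multiplication by <S b, a>. This supplies the hypothesis on
  \<open>Q\<close> in \<open>norm_perturbed_square_le\<close>.\<close>

lemma outer_compression:
  "outer b a * (S * (outer b a * outer a b)) = cinner (op_apply S b) a *\<^sub>C (outer b a * outer a b)"
  by (rule op_eqI) (simp add: op_apply_times op_apply_scaleC_left op_apply_scaleC
      cinner_scaleC_left scaleC_scaleC mult_ac)


section \<open>A faithful representation\<close>

definition orthonormal :: "'a::complex_inner set \<Rightarrow> bool" where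
  "orthonormal E \<longleftrightarrow> (\<forall>x\<in>E. \<forall>y\<in>E. cinner x y = of_bool (x = y))"

text \<open>Zorn's lemma gives a maximal orthonormal set; a nonzero vector orthogonal to it could be
  normalised and added.\<close>

lemma orthonormal_basis_exists:
  "\<exists>E :: 'a::complex_inner set. orthonormal E \<and> (\<forall>x. (\<forall>e\<in>E. cinner x e = 0) \<longrightarrow> x = 0)"
proof -
  have "\<exists>M\<in>{E :: 'a set. orthonormal E}. \<forall>X\<in>{E. orthonormal E}. M \<subseteq> X \<longrightarrow> X = M"
  proof (rule subset_Zorn_nonempty)
    show "{E :: 'a set. orthonormal E} \<noteq> {}" by (auto simp: orthonormal_def)
    fix C :: "'a set set"
    assume "C \<noteq> {}" and C: "subset.chain {E. orthonormal E} C"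
    have "cinner x y = of_bool (x = y)" if "X \<in> C" "x \<in> X" "Y \<in> C" "y \<in> Y" for x y X Y
    proof -
      have "X \<subseteq> Y \<or> Y \<subseteq> X" using C that by (auto simp: subset_chain_def)
      moreover have "orthonormal X" "orthonormal Y" using C that by (auto simp: subset_chain_def)
      ultimately show ?thesis using that by (auto simp: orthonormal_def)
    qed
    then show "\<Union>C \<in> {E. orthonormal E}" by (auto simp: orthonormal_def)
  qed
  then obtain E :: "'a set" where E: "orthonormal E" and
    max: "\<And>X. orthonormal X \<Longrightarrow> E \<subseteq> X \<Longrightarrow> X = E" by auto
  have "x = 0" if x: "\<forall>e\<in>E. cinner x e = 0" for x
  proof (rule ccontr)
    assume "x \<noteq> 0"
    let ?u = "complex_of_real (1 / norm x) *\<^sub>C x"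
    have "cinner ?u ?u = 1"
      using \<open>x \<noteq> 0\<close> by (simp add: cinner_norm norm_scaleC norm_divide)
    moreover have "cinner ?u e = 0 \<and> cinner e ?u = 0" if "e \<in> E" for e
      using x that by (subst (2) cinner_commute) (simp add: cinner_scaleC_left)
    ultimately have "orthonormal (insert ?u E)"
      using E by (auto simp: orthonormal_def)
    then have "?u \<in> E" using max[of "insert ?u E"] by blast
    then have "cinner x ?u = 0" using x by blast
    then show False using \<open>x \<noteq> 0\<close> by (simp add: cinner_scaleC_right cinner_norm)
  qed
  with E show ?thesis by blast
qed

section \<open>Bessel's inequality and coordinates\<close>

lemma clinear_cinner_left: "clinear (\<lambda>x. cinner x (y :: 'a::complex_inner))"
  by (simp add: clinear_def cinner_add_left cinner_scaleC_left scaleC_complex_def)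

lemma bessel_inequality:
  assumes "orthonormal E" "finite F" "F \<subseteq> E"
  shows "(\<Sum>e\<in>F. (cmod (cinner x e))\<^sup>2) \<le> (norm (x :: 'a::complex_inner))\<^sup>2"
proof -
  let ?w = "\<lambda>F. x - (\<Sum>e\<in>F. cinner x e *\<^sub>C e)"
  have "(norm (?w F))\<^sup>2 = (norm x)\<^sup>2 - (\<Sum>e\<in>F. (cmod (cinner x e))\<^sup>2)"
    using assms(2,3)
  proof (induction F)
    case (insert f F)
    have E: "cinner e e' = of_bool (e = e')" if "e \<in> E" "e' \<in> E" for e e'
      using assms(1) that by (simp add: orthonormal_def)
    have "f \<in> E" and "f \<notin> F" using insert by auto
    have "(norm f)\<^sup>2 = 1"
      using E[OF \<open>f \<in> E\<close> \<open>f \<in> E\<close>] by (simp add: cinner_norm del: of_real_power)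
    then have "norm f = 1" using norm_ge_zero[of f] by (auto simp: power2_eq_1_iff)
    then have f: "norm f = 1" "f \<noteq> 0" by auto
    have "cinner (\<Sum>e\<in>F. cinner x e *\<^sub>C e) f = (\<Sum>e\<in>F. cinner x e * cinner e f)"
      by (simp add: clinear_sum[OF clinear_cinner_left] cinner_scaleC_left)
    also have "\<dots> = 0"
      using insert \<open>f \<in> E\<close> by (intro sum.neutral) (auto simp: E subset_iff)
    finally have wf: "cinner (?w F) f = cinner x f" by (simp add: cinner_diff_left)
    \<comment> \<open>By \<open>wf\<close> the residual and \<open>x\<close> have the same
      coefficient at \<open>f\<close>, so the step again removes a projection.\<close>
    have step: "?w (insert f F) = ?w F + (- cinner (?w F) f / (norm f)\<^sup>2) *\<^sub>C f"
    proof -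
      have "(- c) *\<^sub>C f = - (c *\<^sub>C f)" for c
        using scaleC_add_left[of c "- c" f] by (simp add: eq_neg_iff_add_eq_0 add.commute)
      then show ?thesis using insert.hyps by (simp add: wf f)
    qed
    have "(norm (?w (insert f F)))\<^sup>2 = (norm (?w F))\<^sup>2 - (cmod (cinner x f))\<^sup>2"
      unfolding step norm_minus_projection_square[OF f(2)] unfolding wf f by simp
    also have "\<dots> = (norm x)\<^sup>2 - (\<Sum>e\<in>insert f F. (cmod (cinner x e))\<^sup>2)"
      using insert by simp
    finally show ?case .
  qed simp
  then show ?thesis using zero_le_power2[of "norm (?w F)"] by linarith
qed

text \<open>\<open>l\<close> labels the vectors by the prescribed index type; Bessel's inequality
  makes the coordinates square summable.\<close>

lemma coordinate_map_exists:
  fixes E :: "'a::complex_inner set" and l :: "'a \<Rightarrow> 'i"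
  assumes E: "orthonormal E" and l: "inj_on l E"
  shows "\<exists>V :: 'a \<Rightarrow> 'i ell2. clinear V \<and> (\<forall>x. norm (V x) \<le> norm x) \<and>
    (\<forall>x. \<forall>e\<in>E. ell2_nth (V x) (l e) = cinner x e) \<and> (\<forall>e\<in>E. V e = ell2_ket (l e))"
proof -
  \<comment> \<open>Indices that label no vector get coordinate 0.\<close>
  define v where "v x i = (if i \<in> l ` E then cinner x (inv_into E l i) else 0)" for x i
  have vl: "v x (l e) = cinner x e" if "e \<in> E" for x e
    using that l by (simp add: v_def)
  have bound: "L2_set (\<lambda>i. cmod (v x i)) F \<le> norm x" if F: "finite F" for x F
  proof -
    let ?F = "{e\<in>E. l e \<in> F}"
    have inj: "inj_on l ?F" using l by (rule inj_on_subset) auto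
    have "finite ?F" by (rule inj_on_finite[OF inj _ F]) auto
    have "(\<Sum>i\<in>F. (cmod (v x i))\<^sup>2) = (\<Sum>i\<in>l ` ?F. (cmod (v x i))\<^sup>2)"
      using F by (intro sum.mono_neutral_right) (auto simp: v_def)
    also have "\<dots> = (\<Sum>e\<in>?F. (cmod (cinner x e))\<^sup>2)"
      by (subst sum.reindex[OF inj]) (auto simp: vl intro!: sum.cong)
    also have "\<dots> \<le> (norm x)\<^sup>2"
      by (rule bessel_inequality[OF E \<open>finite ?F\<close>]) auto
    finally show ?thesis
      unfolding L2_set_def by (intro real_le_lsqrt) (auto intro: sum_nonneg)
  qed
  have "\<exists>V. \<forall>i. ell2_nth V i = v x i" for x
    by (rule exI[of _ "Abs_ell2 (v x)"])
       (subst ell2_nth.rep_eq, subst Abs_ell2_inverse, auto intro!: ell2_bound(1) bound)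
  then obtain V where V: "\<And>x i. ell2_nth (V x) i = v x i" by metis
  have "V (x + y) = V x + V y" "V (c *\<^sub>C x) = c *\<^sub>C V x" for x y c
    by (rule ell2_eqI, simp add: V v_def cinner_add_left cinner_scaleC_left)+
  then have "clinear V" by (simp add: clinear_def)
  moreover have "norm (V x) \<le> norm x" for x
    by (rule ell2_norm_bound) (simp add: V bound)
  moreover have "V e = ell2_ket (l e)" if "e \<in> E" for e
  proof (rule ell2_eqI)
    fix i
    show "ell2_nth (V e) i = ell2_nth (ell2_ket (l e)) i"
    proof (cases "i \<in> l ` E")
      case True
      then obtain e' where e': "e' \<in> E" "i = l e'" by blast
      have "cinner e e' = of_bool (e = e')" using E that e' by (simp add: orthonormal_def)
      moreover have "l e = l e' \<longleftrightarrow> e = e'" using l that e' by (auto dest: inj_onD)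
      ultimately show ?thesis by (simp add: V vl e')
    qed (use that in \<open>auto simp: V v_def\<close>)
  qed
  ultimately show ?thesis using V vl by metis
qed

text \<open>Representations in \<open>min_norm\<close> act on \<open>'a bop ell2\<close>, so the
  labels must be operators. Equal projections give \<open>x\<close> as <x, y> times
  \<open>y\<close>, hence <x, y> is nonzero and \<open>x = y\<close>.\<close>

lemma inj_on_outer_self: "orthonormal E \<Longrightarrow> inj_on (\<lambda>e. outer e e) E"
proof (rule inj_onI)
  fix x y assume E: "orthonormal E" "x \<in> E" "y \<in> E" and eq: "outer x x = outer y y"
  have "cinner x x = 1" using E by (simp add: orthonormal_def)
  then have "x = cinner x y *\<^sub>C y"
    using arg_cong[OF eq, of "\<lambda>T. op_apply T x"] by (simp add: scaleC_one)
  moreover have "x \<noteq> 0" using \<open>cinner x x = 1\<close> by auto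
  ultimately have "cinner x y \<noteq> 0" by auto
  then show "x = y" using E by (auto simp: orthonormal_def split: if_splits)
qed

text \<open>With an orthonormal basis \<open>E\<close> labelled by the projections \<open>outer e e\<close>, the coordinate map \<open>V\<close> is
  an isometry into \<open>'a bop ell2\<close>, and \<open>T \<mapsto> V T V\<^sup>*\<close> is the representation.\<close>

lemma faithful_representation_exists:
  "\<exists>\<pi> :: 'a::complex_hilbert bop \<Rightarrow> 'a bop ell2 bop. is_representation \<pi> \<and>
    (\<forall>T x. op_apply T x \<noteq> 0 \<longrightarrow> (\<exists>y. op_apply (\<pi> T) y \<noteq> 0))"
proof -
  obtain E :: "'a set" where E: "orthonormal E" and
    basis: "\<And>x. (\<And>e. e \<in> E \<Longrightarrow> cinner x e = 0) \<Longrightarrow> x = 0"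
    using orthonormal_basis_exists by metis
  obtain V :: "'a \<Rightarrow> 'a bop ell2" where V: "clinear V" "\<And>x. norm (V x) \<le> norm x"
    and nth: "\<And>x e. e \<in> E \<Longrightarrow> ell2_nth (V x) (outer e e) = cinner x e"
    and ket: "\<And>e. e \<in> E \<Longrightarrow> V e = ell2_ket (outer e e)"
    using coordinate_map_exists[OF E inj_on_outer_self[OF E]] by metis
  obtain W where W: "clinear W" "\<And>y. norm (W y) \<le> norm y"
    and VW: "\<And>x y. cinner (V x) y = cinner x (W y)"
    using adjoint_exists[of V 1] V by auto
  have WV: "cinner (W y) x = cinner y (V x)" for x y
    by (metis VW cinner_commute)
  \<comment> \<open>Coordinates agree: <W (V x), e> = <V x, V e>, and \<open>V e\<close> is the ket
    labelled \<open>outer e e\<close>.\<close>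
  have inv: "W (V x) = x" for x
  proof -
    have "W (V x) - x = 0"
      by (rule basis) (simp add: cinner_diff_left WV ket cinner_ket nth)
    then show ?thesis by simp
  qed
  have "\<exists>P. op_apply P = (\<lambda>y. V (op_apply T (W y)))" for T
  proof (rule bop_exists)
    show "clinear (\<lambda>y. V (op_apply T (W y)))"
      using V W by (simp add: clinear_def op_apply_add op_apply_scaleC)
    show "norm (V (op_apply T (W y))) \<le> norm T * norm y" for y
      by (rule order_trans[OF V(2)], rule order_trans[OF norm_op_apply])
         (simp add: mult_left_mono W)
  qed
  then obtain \<pi> where \<pi>: "\<And>T. op_apply (\<pi> T) = (\<lambda>y. V (op_apply T (W y)))" by metis
  have "is_representation \<pi>"
    unfolding is_representation_def
  proof (intro conjI allI impI)
    have "\<pi> (S + T) = \<pi> S + \<pi> T" "\<pi> (c *\<^sub>C T) = c *\<^sub>C \<pi> T" for S T c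
      by (rule op_eqI, use V(1) in \<open>simp add: \<pi> op_apply_add_left op_apply_scaleC_left clinear_def\<close>)+
    then show "clinear \<pi>" by (simp add: clinear_def)
    show "\<pi> (S * T) = \<pi> S * \<pi> T" for S T
      by (rule op_eqI) (simp add: \<pi> op_apply_times inv)
    show "is_adjoint (\<pi> S) (\<pi> T)" if "is_adjoint S T" for S T
      using is_adjointD[OF that] by (simp add: is_adjoint_def \<pi> VW flip: WV)
  qed
  \<comment> \<open>\<open>\<pi> T\<close> maps \<open>V x\<close> to \<open>V (T x)\<close>, and
    \<open>V\<close> is injective with left inverse \<open>W\<close>.\<close>
  moreover have "op_apply (\<pi> T) (V x) \<noteq> 0" if "op_apply T x \<noteq> 0" for T x
    using that inv clinear_zero[OF W(1)] unfolding \<pi> by metis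
  ultimately show ?thesis by blast
qed

lemma op_tensor_nonzero:
  assumes "op_apply S x \<noteq> 0" "op_apply T y \<noteq> 0"
  shows "op_apply (op_tensor S T) (ell2_tensor x y) \<noteq> 0"
proof -
  obtain i j where "ell2_nth (op_apply S x) i \<noteq> 0" "ell2_nth (op_apply T y) j \<noteq> 0"
    using assms by (metis ell2_eqI ell2_nth_simps(1))
  then have "ell2_nth (op_apply (op_tensor S T) (ell2_tensor x y)) (i, j) \<noteq> 0"
    by (simp add: op_apply_op_tensor)
  then show ?thesis by auto
qed


section \<open>Birkhoff-James orthogonality of rank one tensors\<close>

lemma scaled_partial_isometry_op_tensor_outer:
  assumes "is_representation \<pi>\<^sub>1" "is_representation \<pi>\<^sub>2"
  shows "scaled_partial_isometry (op_tensor (\<pi>\<^sub>1 (outer b a)) (\<pi>\<^sub>2 (outer d c)))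
    (op_tensor (\<pi>\<^sub>1 (outer a b)) (\<pi>\<^sub>2 (outer c d))) ((norm a * norm b)\<^sup>2 * (norm c * norm d)\<^sup>2)"
  using assms[THEN scaled_partial_isometry_representation, OF scaled_partial_isometry_outer]
  by (rule scaled_partial_isometry_op_tensor)

section \<open>Bounds for the minimal norm\<close>

lemma sqrt_mult_squares: "0 \<le> x \<Longrightarrow> 0 \<le> y \<Longrightarrow> sqrt (x\<^sup>2 * y\<^sup>2) = x * y"
  by (simp add: real_sqrt_mult)

text \<open>Serves twice: it makes the supremum finite on outer products, and it bounds the
  perturbing operator uniformly in the representations.\<close>

lemma norm_op_tensor_representation_le:
  assumes "is_representation \<pi>\<^sub>1" "is_representation \<pi>\<^sub>2"
  shows "norm (op_tensor (\<pi>\<^sub>1 (outer a b)) (\<pi>\<^sub>2 (outer c d))) \<le> norm a * norm b * (norm c * norm d)"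
  using scaled_partial_isometry_norm_le[OF scaled_partial_isometry_op_tensor_outer[OF assms]]
  by (simp add: sqrt_mult_squares)

text \<open>Under faithful representations the tensor operator is nonzero, which forces its norm up
  to \<open>sqrt \<tau>\<close>.\<close>

lemma min_norm_outer_ge:
  fixes a b :: "'a::complex_hilbert" and c d :: "'b::complex_hilbert"
  assumes "a \<noteq> 0" "b \<noteq> 0" "c \<noteq> 0" "d \<noteq> 0"
  shows "norm a * norm b * (norm c * norm d) \<le> min_norm (outer a b \<otimes> outer c d)"
proof -
  obtain \<pi>\<^sub>1 :: "'a bop \<Rightarrow> 'a bop ell2 bop" where \<pi>\<^sub>1: "is_representation \<pi>\<^sub>1"
    and faithful1: "\<And>T x. op_apply T x \<noteq> 0 \<Longrightarrow> \<exists>y. op_apply (\<pi>\<^sub>1 T) y \<noteq> 0"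
    using faithful_representation_exists by metis
  obtain \<pi>\<^sub>2 :: "'b bop \<Rightarrow> 'b bop ell2 bop" where \<pi>\<^sub>2: "is_representation \<pi>\<^sub>2"
    and faithful2: "\<And>T x. op_apply T x \<noteq> 0 \<Longrightarrow> \<exists>y. op_apply (\<pi>\<^sub>2 T) y \<noteq> 0"
    using faithful_representation_exists by metis
  have nonzero: "v *\<^sub>C e \<noteq> 0" if "v \<noteq> 0" "e \<noteq> 0" for v and e :: "'c::complex_normed_vector"
    using that by (subst norm_eq_zero[symmetric]) (simp add: norm_scaleC)
  have "op_apply (outer a b) b \<noteq> 0" "op_apply (outer c d) d \<noteq> 0"
    using assms by (simp_all add: cinner_norm nonzero)
  then obtain x y where "op_apply (\<pi>\<^sub>1 (outer a b)) x \<noteq> 0" "op_apply (\<pi>\<^sub>2 (outer c d)) y \<noteq> 0"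
    using faithful1 faithful2 by metis
  note nz = op_tensor_nonzero[OF this]
  from scaled_partial_isometry_norm_ge[OF scaled_partial_isometry_op_tensor_outer[OF \<pi>\<^sub>1 \<pi>\<^sub>2] _ nz]
  have "norm a * norm b * (norm c * norm d)
      \<le> norm (rep_tensor_product \<pi>\<^sub>1 \<pi>\<^sub>2 (outer a b \<otimes> outer c d))"
    by (simp add: sqrt_mult_squares rep_tensor_product[OF \<pi>\<^sub>1 \<pi>\<^sub>2])
  also have "\<dots> \<le> min_norm (outer a b \<otimes> outer c d)"
    unfolding min_norm_def
    by (rule cSUP_upper2[where x = "(\<pi>\<^sub>1, \<pi>\<^sub>2)"], rule bdd_aboveI2)
       (auto simp: \<pi>\<^sub>1 \<pi>\<^sub>2 rep_tensor_product intro: norm_op_tensor_representation_le)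
  finally show ?thesis .
qed

text \<open>Existence of a faithful representation makes the index set nonempty, as
  \<open>cSUP_least\<close> requires.\<close>

lemma min_norm_leI:
  fixes u :: "('a::complex_hilbert bop, 'b::complex_hilbert bop) tensor"
  assumes "\<And>\<pi>\<^sub>1 \<pi>\<^sub>2. is_representation \<pi>\<^sub>1 \<Longrightarrow> is_representation \<pi>\<^sub>2 \<Longrightarrow>
    norm (rep_tensor_product (\<pi>\<^sub>1 :: _ \<Rightarrow> 'a bop ell2 bop) (\<pi>\<^sub>2 :: _ \<Rightarrow> 'b bop ell2 bop) u) \<le> c"
  shows "min_norm u \<le> c"
  unfolding min_norm_def
  using faithful_representation_exists[where 'a = 'a] faithful_representation_exists[where 'a = 'b]
  by (intro cSUP_least) (auto intro: assms)

theorem proposition3p12: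
  fixes T\<^sub>1 T\<^sub>2 S\<^sub>1 S\<^sub>2 :: "'h::complex_hilbert bop"
    and \<iota> :: "('h bop, 'h bop) tensor \<Rightarrow> 'z::complex_banach"
  assumes "is_min_tensor_product \<iota>"
    and "rank_one T\<^sub>1" "rank_one T\<^sub>2" "rank_one S\<^sub>1" "rank_one S\<^sub>2"
    and "\<iota> (T\<^sub>1 \<otimes> T\<^sub>2) \<bottom>\<^sub>B\<^sub>J \<iota> (S\<^sub>1 \<otimes> S\<^sub>2)"
  shows "T\<^sub>1 \<bottom>\<^sub>B\<^sub>J S\<^sub>1 \<or> T\<^sub>2 \<bottom>\<^sub>B\<^sub>J S\<^sub>2"
proof (rule ccontr)
  assume neg: "\<not> (T\<^sub>1 \<bottom>\<^sub>B\<^sub>J S\<^sub>1 \<or> T\<^sub>2 \<bottom>\<^sub>B\<^sub>J S\<^sub>2)"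
  obtain a\<^sub>1 b\<^sub>1 where T\<^sub>1: "a\<^sub>1 \<noteq> 0" "b\<^sub>1 \<noteq> 0" "T\<^sub>1 = outer a\<^sub>1 b\<^sub>1" using assms(2) rank_one_outer by metis
  obtain a\<^sub>2 b\<^sub>2 where T\<^sub>2: "a\<^sub>2 \<noteq> 0" "b\<^sub>2 \<noteq> 0" "T\<^sub>2 = outer a\<^sub>2 b\<^sub>2" using assms(3) rank_one_outer by metis
  obtain c\<^sub>1 d\<^sub>1 where S\<^sub>1: "S\<^sub>1 = outer c\<^sub>1 d\<^sub>1" using assms(4) rank_one_outer by metis
  obtain c\<^sub>2 d\<^sub>2 where S\<^sub>2: "S\<^sub>2 = outer c\<^sub>2 d\<^sub>2" using assms(5) rank_one_outer by metis
  let ?\<kappa>\<^sub>1 = "cinner (op_apply S\<^sub>1 b\<^sub>1) a\<^sub>1" and ?\<kappa>\<^sub>2 = "cinner (op_apply S\<^sub>2 b\<^sub>2) a\<^sub>2"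
  let ?\<tau> = "(norm a\<^sub>1 * norm b\<^sub>1)\<^sup>2 * (norm a\<^sub>2 * norm b\<^sub>2)\<^sup>2"
  let ?q = "norm c\<^sub>1 * norm d\<^sub>1 * (norm c\<^sub>2 * norm d\<^sub>2)"
  \<comment> \<open>A vanishing factor would give one of the orthogonalities by
    \<open>BJ_orthogonal_outer\<close>.\<close>
  have \<kappa>: "?\<kappa>\<^sub>1 * ?\<kappa>\<^sub>2 \<noteq> 0" using neg T\<^sub>1 T\<^sub>2 BJ_orthogonal_outer by auto
  have \<tau>: "0 < ?\<tau>" using T\<^sub>1 T\<^sub>2 by simp
  have q: "0 \<le> ?q" by simp
  \<comment> \<open>Fixed once, on the space where all products of two representations act.\<close>
  obtain \<alpha> c where c: "c < sqrt ?\<tau>" and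
    perturb: "\<And>A R Q :: ('h bop \<times> 'h bop) ell2 bop. scaled_partial_isometry A R ?\<tau> \<Longrightarrow>
      A * (Q * (A * R)) = (?\<kappa>\<^sub>1 * ?\<kappa>\<^sub>2) *\<^sub>C (A * R) \<Longrightarrow> norm Q \<le> ?q \<Longrightarrow> norm (R + \<alpha> *\<^sub>C Q) \<le> c"
    by (rule perturbation_decreases_norm[OF \<tau> \<kappa> q, where 'a = "('h bop \<times> 'h bop) ell2"]) (rule that)
  have "min_norm (T\<^sub>1 \<otimes> T\<^sub>2 + \<alpha> *\<^sub>C (S\<^sub>1 \<otimes> S\<^sub>2)) \<le> c"
  proof (rule min_norm_leI)
    fix \<pi>\<^sub>1 \<pi>\<^sub>2 :: "'h bop \<Rightarrow> 'h bop ell2 bop"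
    assume \<pi>: "is_representation \<pi>\<^sub>1" "is_representation \<pi>\<^sub>2"
    let ?R = "op_tensor (\<pi>\<^sub>1 T\<^sub>1) (\<pi>\<^sub>2 T\<^sub>2)" and ?Q = "op_tensor (\<pi>\<^sub>1 S\<^sub>1) (\<pi>\<^sub>2 S\<^sub>2)"
    let ?A = "op_tensor (\<pi>\<^sub>1 (outer b\<^sub>1 a\<^sub>1)) (\<pi>\<^sub>2 (outer b\<^sub>2 a\<^sub>2))"
    have compression: "\<pi> (outer b a) * (\<pi> S * (\<pi> (outer b a) * \<pi> (outer a b)))
        = cinner (op_apply S b) a *\<^sub>C (\<pi> (outer b a) * \<pi> (outer a b))"
      if "is_representation \<pi>" for \<pi> :: "'h bop \<Rightarrow> 'h bop ell2 bop" and S a b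
    proof -
      have "\<pi> (S * T) = \<pi> S * \<pi> T" "\<pi> (c *\<^sub>C T) = c *\<^sub>C \<pi> T" for S T c
        using that by (auto simp: is_representation_def clinear_def)
      then show ?thesis using arg_cong[OF outer_compression, of \<pi>] by metis
    qed
    have "norm (?R + \<alpha> *\<^sub>C ?Q) \<le> c"
    proof (rule perturb)
      show "scaled_partial_isometry ?A ?R ?\<tau>"
        unfolding T\<^sub>1 T\<^sub>2 by (rule scaled_partial_isometry_op_tensor_outer[OF \<pi>])
      \<comment> \<open>Both factors satisfy the compression relation, and their scalars
        multiply.\<close>
      show "?A * (?Q * (?A * ?R)) = (?\<kappa>\<^sub>1 * ?\<kappa>\<^sub>2) *\<^sub>C (?A * ?R)"
        unfolding T\<^sub>1 T\<^sub>2 by (simp only: op_tensor_times compression \<pi> op_tensor_scaleC scaleC_scaleC mult.commute)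
      show "norm ?Q \<le> ?q"
        unfolding S\<^sub>1 S\<^sub>2 by (rule norm_op_tensor_representation_le[OF \<pi>])
    qed
    then show "norm (rep_tensor_product \<pi>\<^sub>1 \<pi>\<^sub>2 (T\<^sub>1 \<otimes> T\<^sub>2 + \<alpha> *\<^sub>C (S\<^sub>1 \<otimes> S\<^sub>2))) \<le> c"
      using rep_tensor_product[OF \<pi>] by (simp add: clinear_def)
  qed
  also have "c < sqrt ?\<tau>" by (rule c)
  also have "sqrt ?\<tau> \<le> min_norm (T\<^sub>1 \<otimes> T\<^sub>2)"
    using min_norm_outer_ge[OF T\<^sub>1(1,2) T\<^sub>2(1,2)] by (simp add: T\<^sub>1 T\<^sub>2 real_sqrt_mult)
  finally have "min_norm (T\<^sub>1 \<otimes> T\<^sub>2 + \<alpha> *\<^sub>C (S\<^sub>1 \<otimes> S\<^sub>2)) < min_norm (T\<^sub>1 \<otimes> T\<^sub>2)" .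
  \<comment> \<open>\<iota> carries \<open>min_norm\<close> to the norm, so orthogonality at this
    one \<alpha> contradicts the strict inequality.\<close>
  moreover have "norm (\<iota> u) = min_norm u" "clinear \<iota>" for u
    using assms(1) by (auto simp: is_min_tensor_product_def)
  then have "min_norm (T\<^sub>1 \<otimes> T\<^sub>2) \<le> min_norm (T\<^sub>1 \<otimes> T\<^sub>2 + \<alpha> *\<^sub>C (S\<^sub>1 \<otimes> S\<^sub>2))"
    using assms(6) unfolding BJ_orthogonal_def clinear_def by metis
  ultimately show False by simp
qed

end
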